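(* Let $F:[0,\infty)\to\mathcal{L}(\mathfrak{H})$ be a measurable family of non-negative self-adjoint contractions on a Hilbert space $\mathfrak{H}$ such that $F(0)=\mathds{1}$. For $\tau>0$ put $S(\tau):=(\mathds{1}-F(\tau))/\tau$, and let $H\ge0$ be a self-adjoint operator in $\mathfrak{H}$ such that $\operatorname{s-lim}_{\tau\to+0}(\mathds{1}+S(\tau))^{-1}=(\mathds{1}+H)^{-1}$. Then $$\lim_{n\to\infty}\sup_{t\in\mathcal{I}}\|F(t/n)^n-e^{-tH}\|=0$$ for any bounded interval $\mathcal{I}\subset[0,\infty)$ if and only if $$\lim_{n\to\infty}\sup_{t\in\mathcal{I}}\|(\mathds{1}+tS(t/n))^{-1}-(\mathds{1}+tH)^{-1}\|=0$$ for any bounded interval $\mathcal{I}\subset[0,\infty)$.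
   Context: $\mathcal{L}(\mathfrak{H})$ is the space of bounded linear operators on $\mathfrak{H}$, $\|\cdot\|$ is the operator norm, $\mathds{1}$ is the identity operator, and $\operatorname{s-lim}$ denotes the limit in the strong operator topology. For $t=0$ the expression $tS(t/n)=n(\mathds{1}-F(t/n))$ is understood as $n(\mathds{1}-F(0))=0$, and $(\mathds{1}+0\cdot H)^{-1}$ as $\mathds{1}$. *)

theory Defs
  imports "HOL-Analysis.Analysis"
begin

text \<open>Complex Hilbert spaces. The inner product is antilinear in its first argument. The real
  vector space structure, the norm and the topology are those of the underlying real Hilbert space,
  so that the type \<open>'a \<Rightarrow>\<^sub>L 'a\<close> with its norm (the operator norm) is available; complex linearity of
  its elements is required separately.\<close>

class complex_hilbert = real_inner + complete_space +
  fixes scaleC :: "complex \<Rightarrow> 'a \<Rightarrow> 'a" (infixr "*\<^sub>C" 75)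
    and cinner :: "'a \<Rightarrow> 'a \<Rightarrow> complex"
  assumes scaleC_add_right: "a *\<^sub>C (x + y) = a *\<^sub>C x + a *\<^sub>C y"
    and scaleC_add_left: "(a + b) *\<^sub>C x = a *\<^sub>C x + b *\<^sub>C x"
    and scaleC_scaleC: "a *\<^sub>C b *\<^sub>C x = (a * b) *\<^sub>C x"
    and scaleC_of_real: "complex_of_real r *\<^sub>C x = r *\<^sub>R x"
    and cinner_cnj_commute: "cinner x y = cnj (cinner y x)"
    and cinner_add_right: "cinner x (y + z) = cinner x y + cinner x z"
    and cinner_scaleC_right: "cinner x (a *\<^sub>C y) = a * cinner x y"
    and inner_eq_Re_cinner: "inner x y = Re (cinner x y)"

definition complex_linear :: "('a::complex_hilbert \<Rightarrow>\<^sub>L 'a) \<Rightarrow> bool" where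
  "complex_linear A \<longleftrightarrow> (\<forall>c x. A (c *\<^sub>C x) = c *\<^sub>C A x)"

definition bounded_self_adjoint :: "('a::complex_hilbert \<Rightarrow>\<^sub>L 'a) \<Rightarrow> bool" where
  "bounded_self_adjoint A \<longleftrightarrow> complex_linear A \<and> (\<forall>x y. cinner (A x) y = cinner x (A y))"

text \<open>For self-adjoint operators the quadratic form is real-valued, hence the use of \<open>Re\<close> here and in
  \<open>op_nonneg\<close> below.\<close>

definition bounded_nonneg :: "('a::complex_hilbert \<Rightarrow>\<^sub>L 'a) \<Rightarrow> bool" where
  "bounded_nonneg A \<longleftrightarrow> (\<forall>x. 0 \<le> Re (cinner x (A x)))"

primrec bpower :: "('a::real_normed_vector \<Rightarrow>\<^sub>L 'a) \<Rightarrow> nat \<Rightarrow> ('a \<Rightarrow>\<^sub>L 'a)" where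
  "bpower A 0 = id_blinfun"
| "bpower A (Suc n) = A o\<^sub>L bpower A n"

text \<open>Weak Lebesgue measurability on \<open>[0,\<infinity>)\<close>, the weakest of the usual notions for operator-valued
  functions; on separable spaces it agrees with strong measurability.\<close>

definition measurable_family :: "(real \<Rightarrow> ('a::complex_hilbert \<Rightarrow>\<^sub>L 'a)) \<Rightarrow> bool" where
  "measurable_family F \<longleftrightarrow>
     (\<forall>x y. (\<lambda>t. cinner x (F t y)) \<in> borel_measurable (lebesgue_on {0..}))"

text \<open>An operator in \<open>'a\<close> is a partial map; its domain of definition is \<open>dom A\<close>.\<close>

type_synonym 'a operator = "'a \<rightharpoonup> 'a"

definition of_bounded :: "('a::real_normed_vector \<Rightarrow>\<^sub>L 'a) \<Rightarrow> 'a operator" where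
  "of_bounded A = (\<lambda>x. Some (A x))"

definition op_linear :: "'a::complex_hilbert operator \<Rightarrow> bool" where
  "op_linear A \<longleftrightarrow> 0 \<in> dom A
     \<and> (\<forall>x\<in>dom A. \<forall>y\<in>dom A. A (x + y) = Some (the (A x) + the (A y)))
     \<and> (\<forall>c. \<forall>x\<in>dom A. A (c *\<^sub>C x) = Some (c *\<^sub>C the (A x)))"

definition densely_defined :: "'a::complex_hilbert operator \<Rightarrow> bool" where
  "densely_defined A \<longleftrightarrow> closure (dom A) = UNIV"

definition adjoint_at :: "'a::complex_hilbert operator \<Rightarrow> 'a \<Rightarrow> 'a \<Rightarrow> bool" where
  "adjoint_at A y z \<longleftrightarrow> (\<forall>x\<in>dom A. cinner y (the (A x)) = cinner z x)"

definition op_adjoint :: "'a::complex_hilbert operator \<Rightarrow> 'a operator" where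
  "op_adjoint A = (\<lambda>y. if \<exists>z. adjoint_at A y z then Some (THE z. adjoint_at A y z) else None)"

definition op_self_adjoint :: "'a::complex_hilbert operator \<Rightarrow> bool" where
  "op_self_adjoint A \<longleftrightarrow> op_linear A \<and> densely_defined A \<and> op_adjoint A = A"

definition op_nonneg :: "'a::complex_hilbert operator \<Rightarrow> bool" where
  "op_nonneg A \<longleftrightarrow> (\<forall>x\<in>dom A. 0 \<le> Re (cinner x (the (A x))))"

definition op_uminus :: "'a::complex_hilbert operator \<Rightarrow> 'a operator" where
  "op_uminus A = (\<lambda>x. map_option uminus (A x))"

definition one_plus :: "real \<Rightarrow> 'a::complex_hilbert operator \<Rightarrow> 'a operator" where
  "one_plus t A = (\<lambda>x. map_option (\<lambda>y. x + t *\<^sub>R y) (A x))"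

text \<open>The bounded, everywhere defined inverse.\<close>

definition bounded_inverse :: "'a::complex_hilbert operator \<Rightarrow> ('a \<Rightarrow>\<^sub>L 'a)" where
  "bounded_inverse A =
     (THE B :: 'a \<Rightarrow>\<^sub>L 'a. (\<forall>y. A (B y) = Some y) \<and> (\<forall>x\<in>dom A. B (the (A x)) = x))"

text \<open>\<open>(1 + t A)\<^sup>-\<^sup>1\<close>, with \<open>(1 + 0 A)\<^sup>-\<^sup>1\<close> read as the identity on the whole space even when \<open>A\<close> is
  only densely defined.\<close>

definition inv_one_plus :: "real \<Rightarrow> 'a::complex_hilbert operator \<Rightarrow> ('a \<Rightarrow>\<^sub>L 'a)" where
  "inv_one_plus t A = (if t = 0 then id_blinfun else bounded_inverse (one_plus t A))"

definition C0_semigroup :: "(real \<Rightarrow> ('a::complex_hilbert \<Rightarrow>\<^sub>L 'a)) \<Rightarrow> bool" where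
  "C0_semigroup T \<longleftrightarrow>
     (\<forall>t\<ge>0. complex_linear (T t)) \<and>
     T 0 = id_blinfun \<and>
     (\<forall>s\<ge>0. \<forall>t\<ge>0. T (s + t) = T s o\<^sub>L T t) \<and>
     (\<forall>x. ((\<lambda>t. T t x) \<longlongrightarrow> x) (at_right 0))"

definition generator :: "(real \<Rightarrow> ('a::complex_hilbert \<Rightarrow>\<^sub>L 'a)) \<Rightarrow> 'a operator" where
  "generator T = (\<lambda>x.
     if \<exists>y. ((\<lambda>h. (1 / h) *\<^sub>R (T h x - x)) \<longlongrightarrow> y) (at_right 0)
     then Some (Lim (at_right 0) (\<lambda>h. (1 / h) *\<^sub>R (T h x - x))) else None)"

text \<open>For \<open>t \<ge> 0\<close>, the value at \<open>t\<close> of the strongly continuous semigroup generated by \<open>- A\<close>.\<close>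

definition exp_neg :: "real \<Rightarrow> 'a::complex_hilbert operator \<Rightarrow> ('a \<Rightarrow>\<^sub>L 'a)" where
  "exp_neg t A = (THE B. \<exists>T. C0_semigroup T \<and> generator T = op_uminus A \<and> B = T t)"

end

theory Submission
  imports Defs
begin

text \<open>Write \<open>F\<close> for \<open>F (t / n)\<close>. Since \<open>t * S (t / n) = n * (1 - F)\<close>, both approximating operators are functions of
  the same operator \<open>F\<close> with \<open>0 \<le> F \<le> 1\<close>, namely \<open>F^n\<close> and \<open>Q = (1 + n * (1 - F))^-1\<close>. Both expected limits are functions
  of the resolvent \<open>R = (1 + H)^-1\<close>. The theorem holds because each quantity is, uniformly up to \<open>O (1 / n)\<close>,
  a fixed continuous function of the other, and because it is the same function on both sides:

  \<^item> \<open>exp (- t * H) = g ((1 + t * H)^-1)\<close> for \<open>g r = exp (1 - 1 / r)\<close>, and \<open>\<parallel>F^n - g Q\<parallel> \<le> 4 / (n - 1)\<close> because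
    \<open>\<bar>f^n - exp (- n * (1 - f))\<bar> \<le> 4 / (n - 1)\<close> for \<open>f\<close> in the unit interval (\<open>power_near_exp\<close>);
  \<^item> \<open>(1 + t * H)^-1 = g' (exp (- t * H))\<close> for \<open>g' y = 1 / (1 - ln y)\<close>, and \<open>\<parallel>Q - g' (F^n)\<parallel> \<le> 1 / n\<close> by a
    similar estimate (\<open>resolvent_near_resolvent_of_power\<close>).

  Both \<open>g\<close> and \<open>g'\<close> extend continuously to the unit interval, with value \<open>0\<close> at \<open>0\<close>. A continuous function
  on the unit interval is uniformly approximated by polynomials, so it acts uniformly continuously, in
  the operator norm, on all operators between \<open>0\<close> and \<open>1\<close> (\<open>cfc_uniformly_continuous\<close>). Hence convergence in
  norm, uniform in \<open>t\<close>, passes from either side to the other.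

  The continuous functional calculus \<open>cfc\<close> is built from Bernstein polynomials. They are combinations of
  the operators \<open>A^k (1 - A)^(n - k)\<close>, which are nonnegative and, with the binomial weights, add up to \<open>1\<close>;
  this gives the bound \<open>\<parallel>cfc A f\<parallel> \<le> sup \<bar>f\<bar>\<close> directly. Multiplicativity follows from the convergence of the
  Bernstein operators for \<open>x * f x\<close> (\<open>bern_samples_times_id\<close>), and with it the rule for composition (\<open>cfc_cfc\<close>).

  For the unbounded operator \<open>H\<close>, self-adjointness gives the everywhere defined contraction \<open>R\<close>
  (\<open>ex_unit_resolvent\<close>), and \<open>(1 + t * H)^-1\<close> is \<open>r / (r + t * (1 - r))\<close> of \<open>R\<close> (\<open>inv_one_plus_eq_cfc\<close>). The function
  \<open>exp (t * (1 - 1 / r))\<close> of \<open>R\<close> is a contraction semigroup with generator \<open>- H\<close>, and it is the only strongly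
  continuous semigroup with this generator (\<open>exp_neg_eq_cfc\<close>).\<close>

section \<open>Bernstein operators of a positive contraction\<close>

definition pos_contraction :: "('a::real_inner \<Rightarrow>\<^sub>L 'a) \<Rightarrow> bool" where
  "pos_contraction A \<longleftrightarrow> (\<forall>x y. A x \<bullet> y = x \<bullet> A y) \<and> (\<forall>x. 0 \<le> x \<bullet> A x) \<and> norm A \<le> 1"

text \<open>This is de Casteljau's recursion for \<open>\<Sum>k\<le>n. c k * (n choose k) * A^k * (1 - A)^(n - k)\<close>, the Bernstein
  polynomial with coefficients \<open>c\<close> evaluated at \<open>A\<close>. The recursive form makes the identities
  below plain inductions on the degree.\<close>

primrec bern :: "('a::real_normed_vector \<Rightarrow>\<^sub>L 'a) \<Rightarrow> nat \<Rightarrow> (nat \<Rightarrow> real) \<Rightarrow> ('a \<Rightarrow>\<^sub>L 'a)" where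
  "bern A 0 c = c 0 *\<^sub>R id_blinfun"
| "bern A (Suc n) c = (A o\<^sub>L bern A n (\<lambda>k. c (Suc k))) + ((id_blinfun - A) o\<^sub>L bern A n c)"

lemma bern_cong: "(\<And>k. k \<le> n \<Longrightarrow> c k = d k) \<Longrightarrow> bern A n c = bern A n d"
proof (induction n arbitrary: c d)
  case (Suc n)
  have "bern A n (\<lambda>k. c (Suc k)) = bern A n (\<lambda>k. d (Suc k))" "bern A n c = bern A n d"
    using Suc.prems by (auto intro!: Suc.IH)
  then show ?case by simp
qed simp

lemma bern_add: "bern A n (\<lambda>k. c k + d k) = bern A n c + bern A n d"
  by (induction n arbitrary: c d)
    (auto intro!: blinfun_eqI simp: blinfun.bilinear_simps algebra_simps)

lemma bern_scaleR: "bern A n (\<lambda>k. a * c k) = a *\<^sub>R bern A n c"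
  by (induction n arbitrary: c)
    (auto intro!: blinfun_eqI simp: blinfun.bilinear_simps algebra_simps)

lemma bern_diff: "bern A n (\<lambda>k. c k - d k) = bern A n c - bern A n d"
  using bern_add[of A n c "\<lambda>k. (-1) * d k"] by (simp only: bern_scaleR) simp

lemma bern_const: "bern A n (\<lambda>k. a) = a *\<^sub>R id_blinfun"
  by (induction n) (auto intro!: blinfun_eqI simp: blinfun.bilinear_simps algebra_simps)

lemma bern_commute:
  fixes A B :: "'a::real_normed_vector \<Rightarrow>\<^sub>L 'a"
  assumes "\<And>x. B (A x) = A (B x)"
  shows "B (bern A n c x) = bern A n c (B x)"
  by (induction n arbitrary: c x) (auto simp: blinfun.bilinear_simps assms)

text \<open>Multiplying the \<open>k\<close>-th coefficient by \<open>k\<close> amounts to multiplying by \<open>(n + 1) * A\<close> and lowering the degree,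
  because \<open>k * (n + 1 choose k) = (n + 1) * (n choose (k - 1))\<close>.\<close>

lemma bern_times_index:
  "bern A (Suc n) (\<lambda>k. real k * c k) = real (Suc n) *\<^sub>R (A o\<^sub>L bern A n (\<lambda>k. c (Suc k)))"
proof (induction n arbitrary: c)
  case 0
  show ?case by (auto intro!: blinfun_eqI simp: blinfun.bilinear_simps)
next
  case (Suc n)
  have split: "bern A (Suc n) (\<lambda>k. real (Suc k) * c (Suc k))
      = bern A (Suc n) (\<lambda>k. real k * c (Suc k)) + bern A (Suc n) (\<lambda>k. c (Suc k))"
    unfolding bern_add[symmetric] by (simp add: algebra_simps)
  have "bern A (Suc (Suc n)) (\<lambda>k. real k * c k)
      = (A o\<^sub>L bern A (Suc n) (\<lambda>k. real (Suc k) * c (Suc k)))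
        + ((id_blinfun - A) o\<^sub>L bern A (Suc n) (\<lambda>k. real k * c k))"
    by simp
  also have "\<dots> = real (Suc (Suc n)) *\<^sub>R (A o\<^sub>L bern A (Suc n) (\<lambda>k. c (Suc k)))"
  proof -
    define a X Y where "a = real (Suc n)" and "X = bern A n (\<lambda>k. c (Suc (Suc k)))"
      and "Y = bern A n (\<lambda>k. c (Suc k))"
    have "(A o\<^sub>L (a *\<^sub>R (A o\<^sub>L X) + ((A o\<^sub>L X) + ((id_blinfun - A) o\<^sub>L Y))))
        + ((id_blinfun - A) o\<^sub>L (a *\<^sub>R (A o\<^sub>L Y)))
        = (a + 1) *\<^sub>R (A o\<^sub>L ((A o\<^sub>L X) + ((id_blinfun - A) o\<^sub>L Y)))"
      by (rule blinfun_eqI) (simp add: blinfun.bilinear_simps algebra_simps)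
    then show ?thesis
      unfolding split Suc.IH by (simp add: a_def X_def Y_def add_ac)
  qed
  finally show ?case .
qed

lemma bern_symmetric:
  fixes A :: "'a::real_inner \<Rightarrow>\<^sub>L 'a"
  assumes "\<And>x y. A x \<bullet> y = x \<bullet> A y"
  shows "bern A n c x \<bullet> y = x \<bullet> bern A n c y"
proof (induction n arbitrary: c x y)
  case (Suc n)
  have comm: "A (bern A n c x) = bern A n c (A x)" for c x
    by (rule bern_commute) simp
  show ?case
    by (simp add: blinfun.bilinear_simps inner_simps assms comm Suc.IH)
qed (simp add: blinfun.bilinear_simps)

text \<open>Products of the commuting operators \<open>A\<close> and \<open>1 - A\<close> are nonnegative: squares can be moved to the two
  arguments of the inner product, and \<open>A (1 - A) = A (1 - A) A + (1 - A) A (1 - A)\<close>.\<close>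

lemma pos_contraction_monomial_nonneg:
  fixes A :: "'a::real_inner \<Rightarrow>\<^sub>L 'a"
  assumes A: "pos_contraction A"
  defines "D \<equiv> id_blinfun - A"
  shows "0 \<le> x \<bullet> (blinfun_apply A ^^ i) ((blinfun_apply D ^^ j) x)"
proof -
  have symA: "A x \<bullet> y = x \<bullet> A y" and posA: "0 \<le> x \<bullet> A x" and nA: "norm A \<le> 1" for x y
    using A by (auto simp: pos_contraction_def)
  have D: "D x = x - A x" for x
    by (simp add: D_def blinfun.bilinear_simps)
  have symD: "D x \<bullet> y = x \<bullet> D y" for x y
    by (simp add: D inner_simps symA)
  have posD: "0 \<le> x \<bullet> D x" for x
  proof -
    have "x \<bullet> A x \<le> norm x * norm (A x)" by (rule norm_cauchy_schwarz)
    also have "\<dots> \<le> norm x * (norm A * norm x)"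
      by (intro mult_left_mono norm_blinfun) simp
    also have "\<dots> \<le> norm x * (1 * norm x)"
      by (intro mult_left_mono mult_right_mono nA) simp_all
    finally show ?thesis by (simp add: D inner_simps dot_square_norm power2_eq_square)
  qed
  have DA: "D (A x) = A (D x)" for x
    by (simp add: D blinfun.bilinear_simps)
  have DAj: "(blinfun_apply D ^^ j) (A x) = A ((blinfun_apply D ^^ j) x)" for j x
    by (induction j) (simp_all add: DA)
  have DAD: "(blinfun_apply D ^^ j) (D x) = D ((blinfun_apply D ^^ j) x)" for j x
    by (rule funpow_swap1[symmetric])
  have mixed: "0 \<le> x \<bullet> A (D x)" for x
  proof -
    have "A (D x) = A (D (A x)) + D (A (D x))"
      by (simp add: D blinfun.bilinear_simps)
    then have "x \<bullet> A (D x) = x \<bullet> A (D (A x)) + x \<bullet> D (A (D x))"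
      by (metis inner_add_right)
    then have "x \<bullet> A (D x) = A x \<bullet> D (A x) + D x \<bullet> A (D x)"
      by (simp only: symA symD)
    then show ?thesis using posA[of "D x"] posD[of "A x"] by simp
  qed
  have base1: "0 \<le> x \<bullet> A ((blinfun_apply D ^^ j) x)" for j x
  proof (induction j arbitrary: x rule: induct_nat_012)
    case (ge2 n)
    have "x \<bullet> A ((blinfun_apply D ^^ Suc (Suc n)) x)
        = D x \<bullet> A ((blinfun_apply D ^^ n) (D x))"
      by (simp only: symD DA DAD funpow.simps o_apply)
    then show ?case using ge2(1)[of "D x"] by simp
  qed (auto simp: posA mixed)
  have base2: "0 \<le> x \<bullet> (blinfun_apply D ^^ j) x" for j x
  proof (induction j arbitrary: x rule: induct_nat_012)
    case (ge2 n)
    have "x \<bullet> ((blinfun_apply D ^^ Suc (Suc n)) x) = D x \<bullet> ((blinfun_apply D ^^ n) (D x))"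
      by (simp only: symD funpow.simps o_apply funpow_swap1)
    then show ?case using ge2(1)[of "D x"] by simp
  qed (auto simp: posD)
  show ?thesis
  proof (induction i arbitrary: x rule: induct_nat_012)
    case (ge2 n)
    have "x \<bullet> (blinfun_apply A ^^ Suc (Suc n)) ((blinfun_apply D ^^ j) x)
        = A x \<bullet> (blinfun_apply A ^^ n) ((blinfun_apply D ^^ j) (A x))"
      by (simp only: symA DAj funpow.simps o_apply funpow_swap1)
    then show ?case using ge2(1)[of "A x"] by simp
  qed (auto simp: base1 base2)
qed

text \<open>A Bernstein polynomial with nonnegative coefficients is a nonnegative combination of the products
  above.\<close>

lemma bern_nonneg:
  fixes A :: "'a::real_inner \<Rightarrow>\<^sub>L 'a"
  assumes A: "pos_contraction A" and c: "\<And>k. k \<le> n \<Longrightarrow> 0 \<le> c k"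
  shows "0 \<le> x \<bullet> bern A n c x"
proof -
  define D where "D = id_blinfun - A"
  have DA: "D (A x) = A (D x)" for x
    by (simp add: D_def blinfun.bilinear_simps)
  have DAj: "(blinfun_apply D ^^ j) (A x) = A ((blinfun_apply D ^^ j) x)" for j x
    by (induction j) (simp_all add: DA)
  have add: "(blinfun_apply B ^^ j) (x + y) = (blinfun_apply B ^^ j) x + (blinfun_apply B ^^ j) y"
    for B :: "'a \<Rightarrow>\<^sub>L 'a" and j x y
    by (induction j) (simp_all add: blinfun.bilinear_simps)
  have scale: "(blinfun_apply B ^^ j) (a *\<^sub>R x) = a *\<^sub>R (blinfun_apply B ^^ j) x"
    for B :: "'a \<Rightarrow>\<^sub>L 'a" and j x and a :: real
    by (induction j) (simp_all add: blinfun.bilinear_simps)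
  \<comment> \<open>The induction needs the extra factors \<open>A^i\<close> and \<open>D^j\<close>, which collect the operators split off by
    the recursion.\<close>
  have "0 \<le> x \<bullet> (blinfun_apply A ^^ i) ((blinfun_apply D ^^ j) (bern A n c x))" for i j
    using c
  proof (induction n arbitrary: c i j)
    case 0
    then show ?case
      using pos_contraction_monomial_nonneg[OF A, of x i j, folded D_def]
      by (simp add: blinfun.scaleR_left scale)
  next
    case (Suc n)
    have "(blinfun_apply A ^^ i) ((blinfun_apply D ^^ j) (bern A (Suc n) c x))
        = (blinfun_apply A ^^ Suc i) ((blinfun_apply D ^^ j) (bern A n (\<lambda>k. c (Suc k)) x))
        + (blinfun_apply A ^^ i) ((blinfun_apply D ^^ Suc j) (bern A n c x))"
      by (simp add: blinfun.bilinear_simps add DAj funpow_swap1 D_def[symmetric])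
    moreover have "0 \<le> x \<bullet> (blinfun_apply A ^^ Suc i) ((blinfun_apply D ^^ j) (bern A n (\<lambda>k. c (Suc k)) x))"
      using Suc.prems by (intro Suc.IH) auto
    moreover have "0 \<le> x \<bullet> (blinfun_apply A ^^ i) ((blinfun_apply D ^^ Suc j) (bern A n c x))"
      using Suc.prems by (intro Suc.IH) auto
    ultimately show ?case by (simp only: inner_add_right)
  qed
  from this[of 0 0] show ?thesis by simp
qed

text \<open>Polarization expresses \<open>y \<bullet> B x\<close> by the quadratic form, and the parallelogram law evaluates the resulting
  bound; then \<open>y\<close> is chosen as the multiple of \<open>B x\<close> with the norm of \<open>x\<close>.\<close>

lemma symmetric_norm_le:
  fixes B :: "'a::real_inner \<Rightarrow>\<^sub>L 'a"
  assumes sym: "\<And>x y. B x \<bullet> y = x \<bullet> B y" and C: "0 \<le> C"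
    and form: "\<And>x. \<bar>x \<bullet> B x\<bar> \<le> C * (x \<bullet> x)"
  shows "norm B \<le> C"
proof (rule norm_blinfun_bound[OF C])
  fix x
  show "norm (B x) \<le> C * norm x"
  proof (cases "B x = 0 \<or> x = 0")
    case True
    then show ?thesis using C by auto
  next
    case False
    define y where "y = (norm x / norm (B x)) *\<^sub>R B x"
    have ny: "norm y = norm x" using False by (simp add: y_def)
    have "4 * (y \<bullet> B x) = (x + y) \<bullet> B (x + y) - (x - y) \<bullet> B (x - y)"
      by (simp add: blinfun.bilinear_simps inner_simps sym inner_commute[of "B x" y])
        (metis sym inner_commute)
    also have "\<dots> \<le> C * ((x + y) \<bullet> (x + y)) + C * ((x - y) \<bullet> (x - y))"
      using form[of "x + y"] form[of "x - y"] by linarith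
    also have "\<dots> = C * (2 * (x \<bullet> x) + 2 * (y \<bullet> y))"
      by (simp add: inner_simps inner_commute[of y x] algebra_simps)
    also have "\<dots> = 4 * (C * norm x * norm x)"
      by (simp add: dot_square_norm ny power2_eq_square)
    finally have "y \<bullet> B x \<le> C * norm x * norm x" by simp
    moreover have "y \<bullet> B x = norm x * norm (B x)"
      using False by (simp add: y_def dot_square_norm power2_eq_square)
    ultimately show ?thesis using False by (simp add: mult.commute)
  qed
qed

text \<open>If \<open>\<bar>c k\<bar> \<le> C\<close>, then the polynomials with coefficients \<open>C - c k\<close> and \<open>C + c k\<close> give nonnegative operators.
  So the norm is controlled by the coefficients without a constant depending on the degree.\<close>

lemma bern_norm_le:
  fixes A :: "'a::real_inner \<Rightarrow>\<^sub>L 'a"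
  assumes A: "pos_contraction A" and c: "\<And>k. k \<le> n \<Longrightarrow> \<bar>c k\<bar> \<le> C"
  shows "norm (bern A n c) \<le> C"
proof (rule symmetric_norm_le)
  show "bern A n c x \<bullet> y = x \<bullet> bern A n c y" for x y
    by (rule bern_symmetric) (use A in \<open>auto simp: pos_contraction_def\<close>)
  show "0 \<le> C" using c[of 0] by linarith
  fix x
  have "0 \<le> x \<bullet> bern A n (\<lambda>k. C - c k) x"
    using c by (intro bern_nonneg A) (auto simp: abs_le_iff)
  moreover have "0 \<le> x \<bullet> bern A n (\<lambda>k. C + c k) x"
    using c by (intro bern_nonneg A) (force simp: abs_le_iff)
  ultimately show "\<bar>x \<bullet> bern A n c x\<bar> \<le> C * (x \<bullet> x)"
    by (simp add: bern_diff bern_add bern_const blinfun.bilinear_simps inner_simps)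
qed

text \<open>The numerical Bernstein polynomial follows the same recursion, so that identities for numbers and for
  operators can be matched step by step.\<close>

primrec sbern :: "nat \<Rightarrow> (nat \<Rightarrow> real) \<Rightarrow> real \<Rightarrow> real" where
  "sbern 0 c x = c 0"
| "sbern (Suc n) c x = x * sbern n (\<lambda>k. c (Suc k)) x + (1 - x) * sbern n c x"

lemma sbern_eq: "sbern n c x = (\<Sum>k\<le>n. c k * Bernstein n k x)"
proof (induction n arbitrary: c)
  case 0
  show ?case by (simp add: Bernstein_def)
next
  case (Suc n)
  have pascal: "Bernstein (Suc n) (Suc k) x = x * Bernstein n k x + (1 - x) * Bernstein n (Suc k) x"
    if "k \<le> n" for k
  proof (cases "k = n")
    case False
    then have "n - k = Suc (n - Suc k)" using that by simp
    then show ?thesis by (simp add: Bernstein_def algebra_simps)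
  qed (simp add: Bernstein_def)
  have "(\<Sum>k\<le>Suc n. c k * Bernstein (Suc n) k x)
      = c 0 * Bernstein (Suc n) 0 x + (\<Sum>k\<le>n. c (Suc k) * Bernstein (Suc n) (Suc k) x)"
    by (rule sum.atMost_Suc_shift)
  also have "\<dots> = c 0 * Bernstein (Suc n) 0 x
      + (\<Sum>k\<le>n. x * (c (Suc k) * Bernstein n k x) + (1 - x) * (c (Suc k) * Bernstein n (Suc k) x))"
    by (intro arg_cong2[where f="(+)"] sum.cong) (simp_all add: pascal algebra_simps)
  also have "\<dots> = x * (\<Sum>k\<le>n. c (Suc k) * Bernstein n k x)
      + (1 - x) * (c 0 * Bernstein n 0 x + (\<Sum>k\<le>n. c (Suc k) * Bernstein n (Suc k) x))"
  proof -
    have "Bernstein (Suc n) 0 x = (1 - x) * Bernstein n 0 x" by (simp add: Bernstein_def)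
    then show ?thesis
      by (simp only: sum.distrib sum_distrib_left[symmetric]) (simp add: algebra_simps)
  qed
  also have "c 0 * Bernstein n 0 x + (\<Sum>k\<le>n. c (Suc k) * Bernstein n (Suc k) x)
      = (\<Sum>k\<le>Suc n. c k * Bernstein n k x)"
    by (rule sum.atMost_Suc_shift[symmetric])
  also have "\<dots> = (\<Sum>k\<le>n. c k * Bernstein n k x)"
    by (simp add: Bernstein_def)
  finally show ?case by (simp add: Suc.IH)
qed

lemma continuous_on_sbern [continuous_intros]: "continuous_on S (sbern n c)"
proof -
  have "sbern n c = (\<lambda>x. \<Sum>k\<le>n. c k * Bernstein n k x)"
    by (simp add: sbern_eq fun_eq_iff)
  then show ?thesis by (simp add: Bernstein_def continuous_intros)
qed

lemma sbern_approx:
  assumes "continuous_on {0..1} f" "0 < e"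
  shows "\<forall>\<^sub>F m in sequentially. \<forall>x\<in>{0..1}. \<bar>f x - sbern m (\<lambda>k. f (real k / real m)) x\<bar> < e"
proof -
  from Bernstein_Weierstrass[OF assms] obtain N
    where "\<forall>n x. N \<le> n \<and> x \<in> {0..1} \<longrightarrow> \<bar>f x - (\<Sum>k\<le>n. f (real k / real n) * Bernstein n k x)\<bar> < e"
    by blast
  then show ?thesis unfolding eventually_sequentially sbern_eq by (intro exI[of _ N]) blast
qed

lemma sample_in_unit_interval: "k \<le> n \<Longrightarrow> real k / real n \<in> {0..1}"
  by (cases "n = 0") (auto simp: field_simps)

section \<open>Continuous functions of a positive contraction\<close>

text \<open>The Bernstein polynomials of \<open>f\<close> converge uniformly to \<open>f\<close> on the unit interval, so the limit of their values at \<open>A\<close> is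
  the value of \<open>f\<close> at \<open>A\<close>. For \<open>n = 0\<close> the sample point is \<open>0 / 0 = 0\<close>, which is still in the interval.\<close>

definition cfc :: "('a::{real_inner,banach} \<Rightarrow>\<^sub>L 'a) \<Rightarrow> (real \<Rightarrow> real) \<Rightarrow> ('a \<Rightarrow>\<^sub>L 'a)" where
  "cfc A f = lim (\<lambda>n. bern A n (\<lambda>k. f (real k / real n)))"

lemma bern_samples_norm_le:
  assumes "pos_contraction A" "\<And>x. x \<in> {0..1} \<Longrightarrow> \<bar>f x\<bar> \<le> C"
  shows "norm (bern A n (\<lambda>k. f (real k / real n))) \<le> C"
  by (intro bern_norm_le assms sample_in_unit_interval)

text \<open>The identity for \<open>k * c k\<close> turns the samples of \<open>x * f x\<close> at \<open>k / (n + 1)\<close> into \<open>A\<close> times the samples of \<open>f\<close> at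
  \<open>(k + 1) / (n + 1)\<close>. These points are within \<open>1 / (n + 1)\<close> of \<open>k / n\<close>, and \<open>f\<close> is uniformly continuous.\<close>

lemma bern_samples_times_id:
  fixes A :: "'a::real_inner \<Rightarrow>\<^sub>L 'a"
  assumes A: "pos_contraction A" and f: "continuous_on {0..1} f"
    and lim: "(\<lambda>n. bern A n (\<lambda>k. f (real k / real n))) \<longlonglongrightarrow> B"
  shows "(\<lambda>n. bern A n (\<lambda>k. (real k / real n) * f (real k / real n))) \<longlonglongrightarrow> (A o\<^sub>L B)"
proof -
  have eq: "bern A (Suc n) (\<lambda>k. (real k / real (Suc n)) * f (real k / real (Suc n)))
      = A o\<^sub>L bern A n (\<lambda>k. f (real (Suc k) / real (Suc n)))" for n
  proof -
    have "bern A (Suc n) (\<lambda>k. (real k / real (Suc n)) * f (real k / real (Suc n)))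
        = bern A (Suc n) (\<lambda>k. (1 / real (Suc n)) * (real k * f (real k / real (Suc n))))"
      by simp
    also have "\<dots> = A o\<^sub>L bern A n (\<lambda>k. f (real (Suc k) / real (Suc n)))"
      unfolding bern_scaleR bern_times_index by simp
    finally show ?thesis .
  qed
  have "(\<lambda>n. bern A n (\<lambda>k. f (real (Suc k) / real (Suc n)))
      - bern A n (\<lambda>k. f (real k / real n))) \<longlonglongrightarrow> 0"
  proof (rule LIMSEQ_I)
    fix e :: real assume "0 < e"
    have "uniformly_continuous_on {0..1} f"
      by (intro compact_uniformly_continuous f) simp
    then obtain d where d: "d > 0"
      "\<And>x y. x \<in> {0..1} \<Longrightarrow> y \<in> {0..1} \<Longrightarrow> dist y x < d \<Longrightarrow> dist (f y) (f x) < e / 2"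
      using \<open>0 < e\<close> unfolding uniformly_continuous_on_def by (metis half_gt_zero)
    obtain N :: nat where N: "1 / real (Suc N) < d"
      using d(1) by (metis nat_approx_posE)
    show "\<exists>no. \<forall>n\<ge>no. norm (bern A n (\<lambda>k. f (real (Suc k) / real (Suc n)))
      - bern A n (\<lambda>k. f (real k / real n)) - 0) < e"
    proof (intro exI[of _ "Suc N"] allI impI)
      fix n assume n: "Suc N \<le> n"
      have "norm (bern A n (\<lambda>k. f (real (Suc k) / real (Suc n)) - f (real k / real n))) \<le> e / 2"
      proof (rule bern_norm_le[OF A])
        fix k assume k: "k \<le> n"
        have "real (Suc k) / real (Suc n) - real k / real n = (real n - real k) / (real n * real (Suc n))"
          using n by (simp add: field_simps)
        moreover have "\<dots> \<ge> 0" using k by simp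
        moreover have "(real n - real k) / (real n * real (Suc n)) \<le> real n / (real n * real (Suc n))"
          by (intro divide_right_mono) auto
        moreover have "real n / (real n * real (Suc n)) = 1 / real (Suc n)" using n by simp
        moreover have "1 / real (Suc n) \<le> 1 / real (Suc N)"
          using n by (intro divide_left_mono) auto
        ultimately have "dist (real (Suc k) / real (Suc n)) (real k / real n) < d"
          using N unfolding dist_real_def by linarith
        then show "\<bar>f (real (Suc k) / real (Suc n)) - f (real k / real n)\<bar> \<le> e / 2"
          using d(2)[OF sample_in_unit_interval[of k n] sample_in_unit_interval[of "Suc k" "Suc n"]] k
          by (simp add: dist_real_def del: of_nat_Suc)
      qed
      then show "norm (bern A n (\<lambda>k. f (real (Suc k) / real (Suc n)))
          - bern A n (\<lambda>k. f (real k / real n)) - 0) < e"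
        using \<open>0 < e\<close> by (simp add: bern_diff)
    qed
  qed
  from tendsto_add[OF this lim]
  have "(\<lambda>n. bern A n (\<lambda>k. f (real (Suc k) / real (Suc n)))) \<longlonglongrightarrow> B" by simp
  then have "(\<lambda>n. A o\<^sub>L bern A n (\<lambda>k. f (real (Suc k) / real (Suc n)))) \<longlonglongrightarrow> (A o\<^sub>L B)"
    by (rule bounded_linear.tendsto[OF bounded_bilinear.bounded_linear_right[OF bounded_bilinear_blinfun_compose]])
  then show ?thesis unfolding eq[symmetric] by (rule LIMSEQ_imp_Suc)
qed

text \<open>Writing multiplication by a Bernstein polynomial as repeated multiplication by \<open>x\<close> and \<open>1 - x\<close> shows
  that the approximants respect products, which is the source of multiplicativity.\<close>

lemma bern_samples_times_sbern:
  fixes A :: "'a::real_inner \<Rightarrow>\<^sub>L 'a"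
  assumes A: "pos_contraction A" and f: "continuous_on {0..1} f"
    and lim: "(\<lambda>n. bern A n (\<lambda>k. f (real k / real n))) \<longlonglongrightarrow> B"
  shows "(\<lambda>n. bern A n (\<lambda>k. sbern m c (real k / real n) * f (real k / real n))) \<longlonglongrightarrow> (bern A m c o\<^sub>L B)"
proof (induction m arbitrary: c)
  case 0
  have "c 0 *\<^sub>R id_blinfun o\<^sub>L B = c 0 *\<^sub>R B"
    by (rule blinfun_eqI) (simp add: blinfun.bilinear_simps)
  with tendsto_scaleR[OF tendsto_const lim, of "c 0"] show ?case by (simp add: bern_scaleR)
next
  case (Suc m)
  have step: "(\<lambda>n. bern A n (\<lambda>k. (real k / real n) * (sbern m d (real k / real n) * f (real k / real n))))
      \<longlonglongrightarrow> (A o\<^sub>L (bern A m d o\<^sub>L B))" for d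
    using Suc.IH[of d] by (intro bern_samples_times_id A) (auto intro!: continuous_intros f)
  have alg: "bern A (Suc m) c o\<^sub>L B = (A o\<^sub>L (bern A m (\<lambda>k. c (Suc k)) o\<^sub>L B))
      + (bern A m c o\<^sub>L B) - (A o\<^sub>L (bern A m c o\<^sub>L B))"
    by (rule blinfun_eqI) (simp add: blinfun.bilinear_simps)
  have fn: "sbern (Suc m) c x * f x
      = x * (sbern m (\<lambda>k. c (Suc k)) x * f x) + sbern m c x * f x - x * (sbern m c x * f x)" for x
    by (simp add: algebra_simps)
  show ?case
    unfolding alg fn bern_diff bern_add
    by (intro tendsto_diff tendsto_add step Suc.IH)
qed

lemma bern_samples_sbern:
  fixes A :: "'a::real_inner \<Rightarrow>\<^sub>L 'a"
  assumes A: "pos_contraction A"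
  shows "(\<lambda>n. bern A n (\<lambda>k. sbern m c (real k / real n))) \<longlonglongrightarrow> bern A m c"
proof -
  have "bern A m c o\<^sub>L id_blinfun = bern A m c" by (rule blinfun_eqI) simp
  then show ?thesis
    using bern_samples_times_sbern[OF A, of "\<lambda>_. 1" id_blinfun m c] by (simp add: bern_const)
qed

text \<open>The Bernstein approximants of a continuous function form a Cauchy sequence: this is clear for
  Bernstein polynomials, and these are uniformly dense.\<close>

lemma cfc_tendsto:
  fixes A :: "'a::{real_inner,banach} \<Rightarrow>\<^sub>L 'a"
  assumes A: "pos_contraction A" and f: "continuous_on {0..1} f"
  shows "(\<lambda>n. bern A n (\<lambda>k. f (real k / real n))) \<longlonglongrightarrow> cfc A f"
proof -
  let ?b = "\<lambda>g n. bern A n (\<lambda>k. g (real k / real n))"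
  have "Cauchy (?b f)"
  proof (rule CauchyI)
    fix e :: real assume e: "0 < e"
    have "\<forall>\<^sub>F m in sequentially. \<forall>x\<in>{0..1}. \<bar>f x - sbern m (\<lambda>k. f (real k / real m)) x\<bar> < e / 4"
      using e by (intro sbern_approx f) simp
    then obtain m where m: "\<forall>x\<in>{0..1}. \<bar>f x - sbern m (\<lambda>k. f (real k / real m)) x\<bar> < e / 4"
      by (auto simp: eventually_sequentially)
    define p where "p = sbern m (\<lambda>k. f (real k / real m))"
    have close: "norm (?b f n - ?b p n) \<le> e / 4" for n
    proof -
      have "norm (?b (\<lambda>x. f x - p x) n) \<le> e / 4"
        using m by (intro bern_samples_norm_le A) (auto simp: p_def intro: less_imp_le)
      then show ?thesis by (simp add: bern_diff)
    qed
    have "Cauchy (?b p)"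
      using bern_samples_sbern[OF A] unfolding p_def by (rule LIMSEQ_imp_Cauchy)
    then obtain N where N: "\<forall>i\<ge>N. \<forall>j\<ge>N. norm (?b p i - ?b p j) < e / 4"
      using e CauchyD[of "?b p" "e / 4"] by auto
    show "\<exists>M. \<forall>i\<ge>M. \<forall>j\<ge>M. norm (?b f i - ?b f j) < e"
    proof (intro exI[of _ N] allI impI)
      fix i j assume ij: "N \<le> i" "N \<le> j"
      have "norm (?b f i - ?b f j)
          = norm ((?b f i - ?b p i) + (?b p i - ?b p j) - (?b f j - ?b p j))" by simp
      also have "\<dots> \<le> norm (?b f i - ?b p i) + norm (?b p i - ?b p j) + norm (?b f j - ?b p j)"
        by (meson norm_triangle_ineq norm_triangle_ineq4 order_trans add_mono order_refl)
      also have "\<dots> < e / 4 + e / 4 + e / 4 + e / 4"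
        using close[of i] close[of j] N[rule_format, OF ij] e by linarith
      also have "\<dots> = e" by simp
      finally show "norm (?b f i - ?b f j) < e" .
    qed
  qed
  then show ?thesis unfolding cfc_def
    by (simp add: Cauchy_convergent_iff convergent_LIMSEQ_iff)
qed

lemma cfc_eqI:
  fixes A :: "'a::{real_inner,banach} \<Rightarrow>\<^sub>L 'a"
  assumes "(\<lambda>n. bern A n (\<lambda>k. f (real k / real n))) \<longlonglongrightarrow> B"
  shows "cfc A f = B"
  unfolding cfc_def using assms by (rule limI)

lemma cfc_sbern: "pos_contraction A \<Longrightarrow> cfc A (sbern m c) = bern A m c"
  by (intro cfc_eqI bern_samples_sbern)

lemma cfc_cong:
  assumes "\<And>x. x \<in> {0..1} \<Longrightarrow> f x = g x"
  shows "cfc A f = cfc A g"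
proof -
  have "bern A n (\<lambda>k. f (real k / real n)) = bern A n (\<lambda>k. g (real k / real n))" for n
    by (intro bern_cong assms sample_in_unit_interval)
  then show ?thesis by (simp add: cfc_def)
qed

lemma cfc_const [simp]: "cfc A (\<lambda>_. a) = a *\<^sub>R id_blinfun"
  by (intro cfc_eqI) (simp add: bern_const)

lemma cfc_id:
  assumes "pos_contraction A" shows "cfc A (\<lambda>x. x) = A"
proof -
  have "bern A 1 real = A" by (rule blinfun_eqI) (simp add: blinfun.bilinear_simps)
  then show ?thesis using cfc_sbern[OF assms, of 1 real]
    cfc_cong[of "\<lambda>x. x" "sbern 1 real" A] by simp
qed

lemma cfc_add:
  assumes "pos_contraction A" "continuous_on {0..1} f" "continuous_on {0..1} g"
  shows "cfc A (\<lambda>x. f x + g x) = cfc A f + cfc A g"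
  using assms by (intro cfc_eqI) (auto simp: bern_add intro!: tendsto_add cfc_tendsto)

lemma cfc_diff:
  assumes "pos_contraction A" "continuous_on {0..1} f" "continuous_on {0..1} g"
  shows "cfc A (\<lambda>x. f x - g x) = cfc A f - cfc A g"
  using assms by (intro cfc_eqI) (auto simp: bern_diff intro!: tendsto_diff cfc_tendsto)

lemma cfc_scaleR:
  assumes "pos_contraction A" "continuous_on {0..1} f"
  shows "cfc A (\<lambda>x. a * f x) = a *\<^sub>R cfc A f"
  using assms by (intro cfc_eqI) (auto simp: bern_scaleR intro!: tendsto_scaleR cfc_tendsto)

lemma cfc_norm_le:
  assumes "pos_contraction A" "continuous_on {0..1} f" "\<And>x. x \<in> {0..1} \<Longrightarrow> \<bar>f x\<bar> \<le> C"
  shows "norm (cfc A f) \<le> C"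
  using tendsto_norm[OF cfc_tendsto[OF assms(1,2)]]
  by (rule LIMSEQ_le_const2) (auto intro!: bern_samples_norm_le assms)

lemma cfc_diff_norm_le:
  assumes "pos_contraction A" "continuous_on {0..1} f" "continuous_on {0..1} g"
    and "\<And>x. x \<in> {0..1} \<Longrightarrow> \<bar>f x - g x\<bar> \<le> C"
  shows "norm (cfc A f - cfc A g) \<le> C"
  unfolding cfc_diff[OF assms(1-3), symmetric]
  using assms by (intro cfc_norm_le continuous_intros)

text \<open>The Bernstein polynomials of \<open>f\<close> converge to \<open>f\<close> uniformly, and \<open>cfc A f\<close> is by construction the
  limit of their values at \<open>A\<close>; so it suffices to know the claim for a Bernstein polynomial in
  place of \<open>f\<close>.\<close>

lemma cfc_mult:
  fixes A :: "'a::{real_inner,banach} \<Rightarrow>\<^sub>L 'a"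
  assumes A: "pos_contraction A" and f: "continuous_on {0..1} f" and g: "continuous_on {0..1} g"
  shows "cfc A (\<lambda>x. f x * g x) = cfc A f o\<^sub>L cfc A g"
proof -
  let ?p = "\<lambda>m. sbern m (\<lambda>k. f (real k / real m))"
  have p: "cfc A (\<lambda>x. ?p m x * g x) = bern A m (\<lambda>k. f (real k / real m)) o\<^sub>L cfc A g" for m
    by (intro cfc_eqI bern_samples_times_sbern A g cfc_tendsto)
  have 1: "(\<lambda>m. cfc A (\<lambda>x. ?p m x * g x)) \<longlonglongrightarrow> (cfc A f o\<^sub>L cfc A g)"
    unfolding p by (intro bounded_linear.tendsto[OF bounded_bilinear.bounded_linear_left[OF bounded_bilinear_blinfun_compose]] cfc_tendsto A f)
  have "compact (g ` {0..1})" by (intro compact_continuous_image g) simp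
  then have "bounded (g ` {0..1})" by (rule compact_imp_bounded)
  then obtain G where G: "G > 0" "\<And>x. x \<in> {0..1} \<Longrightarrow> \<bar>g x\<bar> \<le> G"
    by (auto simp: bounded_pos)
  have 2: "(\<lambda>m. cfc A (\<lambda>x. ?p m x * g x)) \<longlonglongrightarrow> cfc A (\<lambda>x. f x * g x)"
  proof (rule metric_LIMSEQ_I)
    fix e :: real assume e: "0 < e"
    have "\<forall>\<^sub>F m in sequentially. \<forall>x\<in>{0..1}. \<bar>f x - ?p m x\<bar> < e / (2 * G)"
      using e G by (intro sbern_approx f) simp
    then have "\<forall>\<^sub>F m in sequentially. dist (cfc A (\<lambda>x. ?p m x * g x)) (cfc A (\<lambda>x. f x * g x)) < e"
    proof eventually_elim
      case (elim m)
      have "norm (cfc A (\<lambda>x. ?p m x * g x) - cfc A (\<lambda>x. f x * g x)) \<le> e / (2 * G) * G"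
      proof (rule cfc_diff_norm_le[OF A])
        fix x :: real assume x: "x \<in> {0..1}"
        have "\<bar>?p m x * g x - f x * g x\<bar> = \<bar>f x - ?p m x\<bar> * \<bar>g x\<bar>"
          by (simp add: abs_mult[symmetric] abs_minus_commute algebra_simps)
        also have "\<dots> \<le> e / (2 * G) * G"
          using elim x G e by (intro mult_mono) (auto intro: less_imp_le)
        finally show "\<bar>?p m x * g x - f x * g x\<bar> \<le> e / (2 * G) * G" .
      qed (intro continuous_intros f g)+
      then show ?case using e G by (simp add: dist_norm)
    qed
    then show "\<exists>no. \<forall>n\<ge>no. dist (cfc A (\<lambda>x. ?p n x * g x)) (cfc A (\<lambda>x. f x * g x)) < e"
      by (simp add: eventually_sequentially)
  qed
  show ?thesis using LIMSEQ_unique[OF 2 1] .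
qed

lemma cfc_commute:
  fixes A B :: "'a::{real_inner,banach} \<Rightarrow>\<^sub>L 'a"
  assumes A: "pos_contraction A" and f: "continuous_on {0..1} f"
    and comm: "\<And>x. B (A x) = A (B x)"
  shows "B (cfc A f x) = cfc A f (B x)"
proof -
  have ap: "(\<lambda>n. bern A n (\<lambda>k. f (real k / real n)) y) \<longlonglongrightarrow> cfc A f y" for y
    by (intro blinfun.tendsto cfc_tendsto A f tendsto_const)
  have "(\<lambda>n. B (bern A n (\<lambda>k. f (real k / real n)) x)) \<longlonglongrightarrow> B (cfc A f x)"
    by (intro blinfun.tendsto tendsto_const ap)
  moreover have "(\<lambda>n. B (bern A n (\<lambda>k. f (real k / real n)) x)) \<longlonglongrightarrow> cfc A f (B x)"
    using ap[of "B x"] by (simp add: bern_commute[OF comm])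
  ultimately show ?thesis by (rule LIMSEQ_unique)
qed

lemma pos_contraction_cfc:
  fixes A :: "'a::{real_inner,banach} \<Rightarrow>\<^sub>L 'a"
  assumes A: "pos_contraction A" and f: "continuous_on {0..1} f" "f ` {0..1} \<subseteq> {0..1}"
  shows "pos_contraction (cfc A f)"
  unfolding pos_contraction_def
proof (intro conjI allI)
  have ap: "(\<lambda>n. bern A n (\<lambda>k. f (real k / real n)) y) \<longlonglongrightarrow> cfc A f y" for y
    by (intro blinfun.tendsto cfc_tendsto A f tendsto_const)
  have in01: "f x \<in> {0..1}" if "x \<in> {0..1}" for x using f(2) that by blast
  show "norm (cfc A f) \<le> 1"
    using in01 by (intro cfc_norm_le A f) force
  fix x
  have "(\<lambda>n. x \<bullet> bern A n (\<lambda>k. f (real k / real n)) x) \<longlonglongrightarrow> x \<bullet> cfc A f x"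
    by (intro tendsto_intros ap)
  moreover have "0 \<le> x \<bullet> bern A n (\<lambda>k. f (real k / real n)) x" for n
    using in01[OF sample_in_unit_interval] by (intro bern_nonneg A) auto
  ultimately show "0 \<le> x \<bullet> cfc A f x"
    by (intro LIMSEQ_le_const) auto
  fix y
  have "(\<lambda>n. bern A n (\<lambda>k. f (real k / real n)) x \<bullet> y) \<longlonglongrightarrow> cfc A f x \<bullet> y"
    by (intro tendsto_intros ap)
  moreover have "(\<lambda>n. x \<bullet> bern A n (\<lambda>k. f (real k / real n)) y) \<longlonglongrightarrow> x \<bullet> cfc A f y"
    by (intro tendsto_intros ap)
  ultimately show "cfc A f x \<bullet> y = x \<bullet> cfc A f y"
    using A by (auto simp: pos_contraction_def bern_symmetric intro: LIMSEQ_unique)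
qed

text \<open>A Bernstein polynomial of \<open>cfc A h\<close> is the same polynomial in \<open>h\<close>, applied to \<open>A\<close>, by multiplicativity;
  pass to the limit.\<close>

lemma cfc_cfc:
  fixes A :: "'a::{real_inner,banach} \<Rightarrow>\<^sub>L 'a"
  assumes A: "pos_contraction A" and h: "continuous_on {0..1} h" "h ` {0..1} \<subseteq> {0..1}"
    and f: "continuous_on {0..1} f"
  shows "cfc (cfc A h) f = cfc A (\<lambda>x. f (h x))"
proof -
  have cont: "continuous_on {0..1} (\<lambda>x. g (h x))" if "continuous_on {0..1} g" for g :: "real \<Rightarrow> real"
    using that h by (rule continuous_on_compose2)
  have bern: "bern (cfc A h) n c = cfc A (\<lambda>x. sbern n c (h x))" for n c
  proof (induction n arbitrary: c)
    case (Suc n)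
    note sb = cont[OF continuous_on_sbern]
    have "cfc A (\<lambda>x. sbern (Suc n) c (h x))
        = (cfc A h o\<^sub>L cfc A (\<lambda>x. sbern n (\<lambda>k. c (Suc k)) (h x)))
        + ((id_blinfun - cfc A h) o\<^sub>L cfc A (\<lambda>x. sbern n c (h x)))"
      by (simp add: cfc_add cfc_mult cfc_diff A h sb continuous_intros)
    then show ?case by (simp add: Suc.IH)
  qed simp
  show ?thesis
  proof (rule cfc_eqI, unfold bern, rule metric_LIMSEQ_I)
    fix e :: real assume e: "0 < e"
    have "\<forall>\<^sub>F m in sequentially. \<forall>x\<in>{0..1}. \<bar>f x - sbern m (\<lambda>k. f (real k / real m)) x\<bar> < e / 2"
      using e by (intro sbern_approx f) simp
    then have "\<forall>\<^sub>F m in sequentially. dist (cfc A (\<lambda>x. sbern m (\<lambda>k. f (real k / real m)) (h x)))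
        (cfc A (\<lambda>x. f (h x))) < e"
    proof eventually_elim
      case (elim m)
      have "norm (cfc A (\<lambda>x. sbern m (\<lambda>k. f (real k / real m)) (h x)) - cfc A (\<lambda>x. f (h x))) \<le> e / 2"
        using elim h by (intro cfc_diff_norm_le A cont continuous_on_sbern f)
          (force simp: abs_minus_commute image_subset_iff intro: less_imp_le)
      then show ?case using e by (simp add: dist_norm)
    qed
    then show "\<exists>no. \<forall>m\<ge>no. dist (cfc A (\<lambda>x. sbern m (\<lambda>k. f (real k / real m)) (h x)))
        (cfc A (\<lambda>x. f (h x))) < e"
      by (simp add: eventually_sequentially)
  qed
qed

lemma bern_lipschitz:
  shows "\<exists>K. \<forall>c A B. pos_contraction (A :: 'a::real_inner \<Rightarrow>\<^sub>L 'a) \<longrightarrow> pos_contraction B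
    \<longrightarrow> (\<forall>k\<le>n. \<bar>c k\<bar> \<le> C) \<longrightarrow> norm (bern A n c - bern B n c) \<le> K * norm (A - B)"
proof (induction n)
  case 0
  show ?case by (intro exI[of _ 0]) simp
next
  case (Suc n)
  then obtain K where K: "\<And>c (A :: 'a \<Rightarrow>\<^sub>L 'a) B. pos_contraction A \<Longrightarrow> pos_contraction B
    \<Longrightarrow> (\<And>k. k \<le> n \<Longrightarrow> \<bar>c k\<bar> \<le> C) \<Longrightarrow> norm (bern A n c - bern B n c) \<le> K * norm (A - B)"
    by blast
  show ?case
  proof (intro exI[of _ "2 * C + 3 * K"] allI impI)
    fix c :: "nat \<Rightarrow> real" and A B :: "'a \<Rightarrow>\<^sub>L 'a"
    assume A: "pos_contraction A" and B: "pos_contraction B" and c: "\<forall>k\<le>Suc n. \<bar>c k\<bar> \<le> C"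
    have nA: "norm A \<le> 1" using A by (simp add: pos_contraction_def)
    have nD: "norm (id_blinfun - A) \<le> 2"
      using norm_triangle_ineq4[of id_blinfun A] nA norm_blinfun_id_le[where 'a='a] by linarith
    let ?X = "\<lambda>A. bern A n (\<lambda>k. c (Suc k))" and ?Y = "\<lambda>A. bern A n c"
    have X: "norm (?X A - ?X B) \<le> K * norm (A - B)" and Y: "norm (?Y A - ?Y B) \<le> K * norm (A - B)"
      using c by (auto intro!: K A B)
    have XB: "norm (?X B) \<le> C" and YB: "norm (?Y B) \<le> C"
      using c by (auto intro!: bern_norm_le B)
    have "bern A (Suc n) c - bern B (Suc n) c
        = ((A o\<^sub>L (?X A - ?X B)) + ((A - B) o\<^sub>L ?X B))
          + (((id_blinfun - A) o\<^sub>L (?Y A - ?Y B)) - ((A - B) o\<^sub>L ?Y B))"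
      by (rule blinfun_eqI) (simp add: blinfun.bilinear_simps)
    also have "norm \<dots> \<le> (norm A * norm (?X A - ?X B) + norm (A - B) * norm (?X B))
        + (norm (id_blinfun - A) * norm (?Y A - ?Y B) + norm (A - B) * norm (?Y B))"
      by (intro norm_triangle_le norm_triangle_le_diff add_mono norm_blinfun_compose order_refl)
    also have "\<dots> \<le> (1 * (K * norm (A - B)) + norm (A - B) * C)
        + (2 * (K * norm (A - B)) + norm (A - B) * C)"
      by (intro add_mono mult_mono nA nD X Y XB YB) auto
    finally show "norm (bern A (Suc n) c - bern B (Suc n) c) \<le> (2 * C + 3 * K) * norm (A - B)"
      by (simp add: algebra_simps)
  qed
qed

text \<open>The modulus of continuity does not depend on the operators, because a fixed Bernstein polynomial
  is within \<open>e / 4\<close> of \<open>f\<close> simultaneously for all of them.\<close>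

lemma cfc_uniformly_continuous:
  assumes f: "continuous_on {0..1} f" and e: "0 < e"
  shows "\<exists>d>0. \<forall>A B. pos_contraction (A :: 'a::{real_inner,banach} \<Rightarrow>\<^sub>L 'a) \<longrightarrow> pos_contraction B
    \<longrightarrow> norm (A - B) < d \<longrightarrow> norm (cfc A f - cfc B f) < e"
proof -
  have "\<forall>\<^sub>F m in sequentially. \<forall>x\<in>{0..1}. \<bar>f x - sbern m (\<lambda>k. f (real k / real m)) x\<bar> < e / 4"
    using e by (intro sbern_approx f) simp
  then obtain m where m: "\<forall>x\<in>{0..1}. \<bar>f x - sbern m (\<lambda>k. f (real k / real m)) x\<bar> < e / 4"
    by (auto simp: eventually_sequentially)
  define c where "c = (\<lambda>k. f (real k / real m))"
  have close: "norm (cfc A f - bern A m c) \<le> e / 4" if "pos_contraction A" for A :: "'a \<Rightarrow>\<^sub>L 'a"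
    unfolding cfc_sbern[OF that, symmetric] using m that
    by (intro cfc_diff_norm_le f continuous_on_sbern) (auto simp: c_def intro: less_imp_le)
  obtain K where K: "\<And>(A :: 'a \<Rightarrow>\<^sub>L 'a) B. pos_contraction A \<Longrightarrow> pos_contraction B
     \<Longrightarrow> norm (bern A m c - bern B m c) \<le> K * norm (A - B)"
    using bern_lipschitz[of m "Max ((\<lambda>k. \<bar>c k\<bar>) ` {..m})", where 'a='a] by (metis Max_ge atMost_iff finite_atMost finite_imageI imageI)
  show ?thesis
  proof (intro exI[of _ "e / (4 * (\<bar>K\<bar> + 1))"] conjI allI impI)
    show "0 < e / (4 * (\<bar>K\<bar> + 1))" using e by simp
    fix A B :: "'a \<Rightarrow>\<^sub>L 'a"
    assume A: "pos_contraction A" and B: "pos_contraction B" and d: "norm (A - B) < e / (4 * (\<bar>K\<bar> + 1))"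
    have "K * norm (A - B) \<le> (\<bar>K\<bar> + 1) * norm (A - B)"
      by (intro mult_right_mono) auto
    also have "\<dots> < e / 4" using d by (simp add: field_simps)
    finally have "norm (bern A m c - bern B m c) < e / 4" using K[OF A B] by linarith
    moreover have "norm (cfc A f - cfc B f)
        \<le> norm (cfc A f - bern A m c) + norm (bern A m c - bern B m c) + norm (cfc B f - bern B m c)"
    proof -
      have "cfc A f - cfc B f = (cfc A f - bern A m c) + (bern A m c - bern B m c) - (cfc B f - bern B m c)"
        by simp
      then show ?thesis
        by (metis (no_types, lifting) norm_triangle_ineq norm_triangle_ineq4 order_trans add_right_mono)
    qed
    ultimately show "norm (cfc A f - cfc B f) < e"
      using close[OF A] close[OF B] e by linarith
  qed
qed

section \<open>The resolvent of a nonnegative self-adjoint operator\<close>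

instance complex_hilbert \<subseteq> banach ..

text \<open>A minimizing sequence for the distance to a point \<open>z\<close> is Cauchy by the parallelogram law, and \<open>z\<close> minus
  its limit is orthogonal to the subspace.\<close>

lemma closed_subspace_eq_UNIV:
  fixes M :: "'a::{real_inner,banach} set"
  assumes sub: "subspace M" and closed: "closed M"
    and orth: "\<And>y. (\<And>m. m \<in> M \<Longrightarrow> y \<bullet> m = 0) \<Longrightarrow> y = 0"
  shows "M = UNIV"
proof -
  have "z \<in> M" for z
  proof -
    define d where "d = infdist z M"
    have ne: "M \<noteq> {}" using subspace_0[OF sub] by auto
    have d0: "0 \<le> d" by (simp add: d_def infdist_nonneg)
    have dle: "d\<^sup>2 \<le> (norm (z - m))\<^sup>2" if "m \<in> M" for m
      using infdist_le[OF that, of z] d0 by (intro power_mono) (auto simp: d_def dist_norm)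
    have "\<exists>m\<in>M. norm (z - m) < d + 1 / real (Suc n)" for n
    proof (rule ccontr)
      assume "\<not> ?thesis"
      then have "d + 1 / real (Suc n) \<le> dist z m" if "m \<in> M" for m
        using that by (auto simp: dist_norm not_less)
      then have "d + 1 / real (Suc n) \<le> infdist z M"
        unfolding infdist_notempty[OF ne] by (intro cINF_greatest ne)
      then show False by (simp add: d_def)
    qed
    then obtain m where mM: "\<And>n. m n \<in> M" and m: "\<And>n. norm (z - m n) < d + 1 / real (Suc n)"
      by metis
    define b where "b n = 4 * ((d + 1 / real (Suc n))\<^sup>2 - d\<^sup>2)" for n
    have "(\<lambda>n. 1 / real (Suc n)) \<longlonglongrightarrow> 0"
      using LIMSEQ_inverse_real_of_nat by (simp add: inverse_eq_divide)
    then have "b \<longlonglongrightarrow> 4 * ((d + 0)\<^sup>2 - d\<^sup>2)"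
      unfolding b_def by (intro tendsto_intros)
    then have b0: "b \<longlonglongrightarrow> 0" by simp
    have close: "(norm (m i - m j))\<^sup>2 \<le> b N" if "N \<le> i" "N \<le> j" for i j N
    proof -
      let ?mid = "(1/2) *\<^sub>R (m i + m j)"
      have "?mid \<in> M" using sub mM by (intro subspace_scale subspace_add)
      have sq: "(norm (z - m k))\<^sup>2 \<le> (d + 1 / real (Suc N))\<^sup>2" if "N \<le> k" for k
      proof (rule power_mono)
        have "1 / real (Suc k) \<le> 1 / real (Suc N)" using that by (intro divide_left_mono) auto
        then show "norm (z - m k) \<le> d + 1 / real (Suc N)" using m[of k] by linarith
      qed simp
      have "(norm (m i - m j))\<^sup>2
          = 2 * (norm (z - m i))\<^sup>2 + 2 * (norm (z - m j))\<^sup>2 - 4 * (norm (z - ?mid))\<^sup>2"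
      proof -
        define u v where "u = z - m i" and "v = z - m j"
        have "m i - m j = v - u" "z - ?mid = (1/2) *\<^sub>R (u + v)"
          by (simp_all add: u_def v_def algebra_simps flip: scaleR_add_left)
        then show ?thesis
          unfolding u_def[symmetric] v_def[symmetric]
          by (simp add: power_divide)
            (simp add: power2_norm_eq_inner inner_add_left inner_add_right inner_diff_left
              inner_diff_right inner_commute[of v u])
      qed
      also have "\<dots> \<le> b N"
        using sq[OF that(1)] sq[OF that(2)] dle[OF \<open>?mid \<in> M\<close>] by (simp add: b_def)
      finally show ?thesis .
    qed
    have "Cauchy m"
    proof (rule CauchyI)
      fix e :: real assume e: "0 < e"
      then have "\<forall>\<^sub>F n in sequentially. b n < e\<^sup>2"
        by (intro order_tendstoD(2)[OF b0]) simp
      then obtain N where N: "b N < e\<^sup>2" by (auto simp: eventually_sequentially)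
      show "\<exists>M. \<forall>i\<ge>M. \<forall>j\<ge>M. norm (m i - m j) < e"
      proof (intro exI[of _ N] allI impI)
        fix i j assume "N \<le> i" "N \<le> j"
        then have "(norm (m i - m j))\<^sup>2 < e\<^sup>2" using close N by (meson le_less_trans)
        then show "norm (m i - m j) < e" using e by (intro power2_less_imp_less[of _ e]) auto
      qed
    qed
    then obtain p where p: "m \<longlonglongrightarrow> p" using Cauchy_convergent_iff convergent_def by blast
    have pM: "p \<in> M" using closed mM p by (auto simp: closed_sequential_limits)
    have "norm (z - p) \<le> d"
    proof (rule LIMSEQ_le)
      show "(\<lambda>n. norm (z - m n)) \<longlonglongrightarrow> norm (z - p)" by (intro tendsto_intros p)
      have "(\<lambda>n. d + 1 / real (Suc n)) \<longlonglongrightarrow> d + 0"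
        by (intro tendsto_add tendsto_const) (use LIMSEQ_inverse_real_of_nat in \<open>simp add: inverse_eq_divide\<close>)
      then show "(\<lambda>n. d + 1 / real (Suc n)) \<longlonglongrightarrow> d" by simp
      show "\<exists>N. \<forall>n\<ge>N. norm (z - m n) \<le> d + 1 / real (Suc n)" using m by (meson less_imp_le)
    qed
    then have dp: "(norm (z - p))\<^sup>2 \<le> d\<^sup>2" by (intro power_mono) auto
    have "z - p = 0"
    proof (rule orth, rule ccontr)
      fix u assume u: "u \<in> M" and nz: "(z - p) \<bullet> u \<noteq> 0"
      \<comment> \<open>The best approximation of \<open>z - p\<close> by multiples of \<open>u\<close> would be strictly closer.\<close>
      define t where "t = ((z - p) \<bullet> u) / (u \<bullet> u)"
      have "u \<noteq> 0" using nz by auto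
      then have uu: "u \<bullet> u > 0" by simp
      have "p + t *\<^sub>R u \<in> M" using sub pM u by (intro subspace_add subspace_scale)
      then have "(norm (z - p))\<^sup>2 \<le> (norm (z - (p + t *\<^sub>R u)))\<^sup>2"
        using dle dp by (meson order_trans)
      also have "z - (p + t *\<^sub>R u) = (z - p) - t *\<^sub>R u" by simp
      also have "(norm ((z - p) - t *\<^sub>R u))\<^sup>2
          = (norm (z - p))\<^sup>2 - 2 * t * ((z - p) \<bullet> u) + t * t * (u \<bullet> u)"
        by (simp add: power2_norm_eq_inner inner_diff_left[of "z - p"] inner_diff_right[of _ "z - p"]
            inner_commute[of u "z - p"] right_diff_distrib)
      also have "t * t * (u \<bullet> u) = t * ((z - p) \<bullet> u)"
        using uu by (simp add: t_def)
      finally have "t * ((z - p) \<bullet> u) \<le> 0" by simp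
      moreover have "t * ((z - p) \<bullet> u) = ((z - p) \<bullet> u)\<^sup>2 / (u \<bullet> u)"
        by (simp add: t_def power2_eq_square)
      moreover have "((z - p) \<bullet> u)\<^sup>2 / (u \<bullet> u) > 0" using nz uu by simp
      ultimately show False by linarith
    qed
    then show "z \<in> M" using pM by simp
  qed
  then show ?thesis by blast
qed

lemma dense_orthogonal_eq_0:
  fixes w :: "'a::real_inner"
  assumes "closure D = UNIV" "\<And>x. x \<in> D \<Longrightarrow> w \<bullet> x = 0"
  shows "w = 0"
proof -
  have "closure D \<subseteq> {x. w \<bullet> x = 0}"
    using assms(2) by (intro closure_minimal closed_hyperplane) auto
  then have "w \<in> {x. w \<bullet> x = 0}" using assms(1) by blast
  then show ?thesis by simp
qed

lemma Im_cinner: "Im (cinner x y) = x \<bullet> ((- \<i>) *\<^sub>C (y :: 'a::complex_hilbert))"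
  by (simp add: inner_eq_Re_cinner cinner_scaleC_right)

lemma op_linear_add:
  "op_linear A \<Longrightarrow> A x = Some x' \<Longrightarrow> A y = Some y' \<Longrightarrow> A (x + y) = Some (x' + y')"
  unfolding op_linear_def by (metis domI option.sel)

lemma op_linear_scaleC: "op_linear A \<Longrightarrow> A x = Some y \<Longrightarrow> A (c *\<^sub>C x) = Some (c *\<^sub>C y)"
  unfolding op_linear_def by (metis domI option.sel)

lemma op_linear_scaleR: "op_linear A \<Longrightarrow> A x = Some y \<Longrightarrow> A (r *\<^sub>R x) = Some (r *\<^sub>R y)"
  by (metis op_linear_scaleC scaleC_of_real)

lemma op_linear_diff:
  assumes "op_linear A" "A x = Some x'" "A y = Some y'"
  shows "A (x - y) = Some (x' - y')"
  using op_linear_add[OF assms(1,2) op_linear_scaleR[OF assms(1,3), of "-1"]] by simp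

text \<open>Since the domain is a complex subspace, the real part of the inner product suffices.\<close>

lemma adjoint_at_iff_real:
  assumes A: "op_linear A"
  shows "adjoint_at A y z \<longleftrightarrow> (\<forall>x x'. A x = Some x' \<longrightarrow> y \<bullet> x' = z \<bullet> x)"
proof
  assume L: "adjoint_at A y z"
  show "\<forall>x x'. A x = Some x' \<longrightarrow> y \<bullet> x' = z \<bullet> x"
    using L unfolding adjoint_at_def inner_eq_Re_cinner by (metis domI option.sel)
next
  assume R: "\<forall>x x'. A x = Some x' \<longrightarrow> y \<bullet> x' = z \<bullet> x"
  show "adjoint_at A y z"
    unfolding adjoint_at_def
  proof
    fix x assume "x \<in> dom A"
    then obtain x' where x': "A x = Some x'" by blast
    have "A ((- \<i>) *\<^sub>C x) = Some ((- \<i>) *\<^sub>C x')" by (rule op_linear_scaleC[OF A x'])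
    then show "cinner y (the (A x)) = cinner z x"
      using R x' by (intro complex_eqI) (auto simp: Im_cinner inner_eq_Re_cinner[symmetric])
  qed
qed

text \<open>This is \<open>H = H*\<close> read off the graph; in particular \<open>H\<close> is closed and symmetric.\<close>

lemma self_adjoint_graph:
  assumes H: "op_self_adjoint H"
  shows "H x = Some y \<longleftrightarrow> (\<forall>u u'. H u = Some u' \<longrightarrow> x \<bullet> u' = y \<bullet> u)"
proof -
  have lin: "op_linear H" and dense: "closure (dom H) = UNIV" and adj: "op_adjoint H = H"
    using H by (auto simp: op_self_adjoint_def densely_defined_def)
  have unique: "z = z'" if "adjoint_at H x z" "adjoint_at H x z'" for z z'
  proof -
    have "z - z' = 0"
      using that by (intro dense_orthogonal_eq_0[OF dense])
        (auto simp: adjoint_at_iff_real[OF lin] inner_diff_left)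
    then show ?thesis by simp
  qed
  then have the: "(THE z. adjoint_at H x z) = z" if "adjoint_at H x z" for z
    using that by (intro the_equality) auto
  have "H x = Some y \<longleftrightarrow> op_adjoint H x = Some y" by (simp add: adj)
  also have "\<dots> \<longleftrightarrow> adjoint_at H x y" unfolding op_adjoint_def using the by auto
  finally show ?thesis by (simp add: adjoint_at_iff_real[OF lin])
qed

lemma op_nonneg_inner: "op_nonneg H \<Longrightarrow> H x = Some y \<Longrightarrow> 0 \<le> x \<bullet> y"
  unfolding op_nonneg_def inner_eq_Re_cinner by (metis domI option.sel)

lemma nonneg_norm_le:
  assumes "op_nonneg H" "H x = Some y" "0 \<le> t"
  shows "norm x \<le> norm (x + t *\<^sub>R y)"
proof (cases "x = 0")
  case False
  have "norm x * norm x = x \<bullet> x" by (simp add: dot_square_norm power2_eq_square)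
  also have "\<dots> \<le> x \<bullet> (x + t *\<^sub>R y)"
    using op_nonneg_inner[OF assms(1,2)] assms(3) by (simp add: inner_simps)
  also have "\<dots> \<le> norm x * norm (x + t *\<^sub>R y)" by (rule norm_cauchy_schwarz)
  finally show ?thesis using False by simp
qed simp

text \<open>\<open>R\<close> is the bounded operator \<open>(1 + H)^-1\<close>, described by \<open>H R z = z - R z\<close>.\<close>

definition unit_resolvent :: "'a::complex_hilbert operator \<Rightarrow> ('a \<Rightarrow>\<^sub>L 'a) \<Rightarrow> bool" where
  "unit_resolvent H R \<longleftrightarrow> pos_contraction R \<and> complex_linear R \<and> (\<forall>z. H (R z) = Some (z - R z))"

lemma unit_resolvent_inverse:
  assumes H: "op_linear H" "op_nonneg H" and R: "unit_resolvent H R" and xy: "H x = Some y"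
  shows "R (x + y) = x"
proof -
  have "H (R (x + y)) = Some (x + y - R (x + y))"
    using R by (simp add: unit_resolvent_def)
  from op_linear_diff[OF H(1) this xy]
  have "H (R (x + y) - x) = Some (- (R (x + y) - x))" by simp
  from nonneg_norm_le[OF H(2) this, of 1] show ?thesis by simp
qed

text \<open>The range of \<open>1 + H\<close> is closed because \<open>1 + H\<close> is bounded below by \<open>1\<close> and \<open>H\<close> is closed. A vector \<open>w\<close>
  orthogonal to the range satisfies \<open>H w = - w\<close>, so it vanishes by nonnegativity.\<close>

lemma one_plus_surj:
  assumes H: "op_self_adjoint H" and pos: "op_nonneg H"
  shows "\<exists>x y. H x = Some y \<and> x + y = z"
proof -
  have lin: "op_linear H" using H by (simp add: op_self_adjoint_def)
  define M where "M = {x + y | x y. H x = Some y}"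
  have "M = UNIV"
  proof (rule closed_subspace_eq_UNIV)
    show "subspace M"
      unfolding subspace_def
    proof (intro conjI ballI allI)
      obtain x0 where "H 0 = Some x0" using lin by (auto simp: op_linear_def)
      from op_linear_scaleR[OF lin this, of 0] show "0 \<in> M" unfolding M_def by force
      show "a + b \<in> M" if ab: "a \<in> M" "b \<in> M" for a b
      proof -
        obtain x y x' y' where "a = x + y" "H x = Some y" "b = x' + y'" "H x' = Some y'"
          using ab unfolding M_def by blast
        then show ?thesis unfolding M_def
          by (intro CollectI exI[of _ "x + x'"] exI[of _ "y + y'"]) (auto simp: op_linear_add[OF lin])
      qed
      show "c *\<^sub>R a \<in> M" if a: "a \<in> M" for c a
      proof -
        obtain x y where "a = x + y" "H x = Some y" using a unfolding M_def by blast
        then show ?thesis unfolding M_def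
          by (intro CollectI exI[of _ "c *\<^sub>R x"] exI[of _ "c *\<^sub>R y"])
            (auto simp: op_linear_scaleR[OF lin] scaleR_add_right)
      qed
    qed
    show "closed M"
      unfolding closed_sequential_limits
    proof (intro allI impI, elim conjE)
      fix w l assume w: "\<forall>n. w n \<in> M" and l: "w \<longlonglongrightarrow> l"
      have "\<forall>n. \<exists>x y. w n = x + y \<and> H x = Some y" using w unfolding M_def by blast
      then obtain x y where xy: "\<And>n. w n = x n + y n" "\<And>n. H (x n) = Some (y n)" by metis
      have "Cauchy x"
      proof (rule CauchyI)
        fix e :: real assume "0 < e"
        then obtain N where N: "\<forall>i\<ge>N. \<forall>j\<ge>N. norm (w i - w j) < e"
          using LIMSEQ_imp_Cauchy[OF l] CauchyD by blast
        have "norm (x i - x j) \<le> norm (w i - w j)" for i j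
          using nonneg_norm_le[OF pos op_linear_diff[OF lin xy(2)[of i] xy(2)[of j]], of 1]
          by (simp add: xy(1) algebra_simps)
        then show "\<exists>M. \<forall>i\<ge>M. \<forall>j\<ge>M. norm (x i - x j) < e" using N by (meson le_less_trans)
      qed
      then obtain p where p: "x \<longlonglongrightarrow> p" using Cauchy_convergent_iff convergent_def by blast
      have "(\<lambda>n. w n - x n) \<longlonglongrightarrow> l - p" by (intro tendsto_diff l p)
      then have q: "y \<longlonglongrightarrow> l - p" by (simp add: xy(1))
      have "H p = Some (l - p)"
        unfolding self_adjoint_graph[OF H, of p]
      proof (intro allI impI)
        fix u u' assume u: "H u = Some u'"
        have "x n \<bullet> u' = y n \<bullet> u" for n
          using xy(2)[of n] u unfolding self_adjoint_graph[OF H, of "x n"] by blast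
        moreover have "(\<lambda>n. x n \<bullet> u') \<longlonglongrightarrow> p \<bullet> u'" "(\<lambda>n. y n \<bullet> u) \<longlonglongrightarrow> (l - p) \<bullet> u"
          by (intro tendsto_intros p q)+
        ultimately show "p \<bullet> u' = (l - p) \<bullet> u" by (simp add: LIMSEQ_unique)
      qed
      then show "l \<in> M" unfolding M_def by force
    qed
    fix w assume w: "\<And>m. m \<in> M \<Longrightarrow> w \<bullet> m = 0"
    have "H w = Some (- w)"
      unfolding self_adjoint_graph[OF H, of w]
    proof (intro allI impI)
      fix u u' assume "H u = Some u'"
      then have "w \<bullet> (u + u') = 0" by (intro w) (auto simp: M_def)
      then show "w \<bullet> u' = - w \<bullet> u" by (simp add: inner_add_right)
    qed
    from nonneg_norm_le[OF pos this, of 1] show "w = 0" by simp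
  qed
  then have "z \<in> M" by simp
  then show ?thesis unfolding M_def by blast
qed

lemma ex_unit_resolvent:
  assumes H: "op_self_adjoint H" and pos: "op_nonneg H"
  shows "\<exists>R. unit_resolvent H R"
proof -
  have lin: "op_linear H" using H by (simp add: op_self_adjoint_def)
  have "\<forall>z. \<exists>x. H x = Some (z - x)"
    using one_plus_surj[OF H pos] by (metis add_diff_cancel_left')
  then obtain r where r: "\<And>z. H (r z) = Some (z - r z)" by metis
  have unique: "x = r (x + y)" if "H x = Some y" for x y
  proof -
    from op_linear_diff[OF lin that r[of "x + y"]]
    have "H (x - r (x + y)) = Some (- (x - r (x + y)))" by simp
    from nonneg_norm_le[OF pos this, of 1] show ?thesis by simp
  qed
  have radd: "r (x + y) = r x + r y" for x y
    using unique[OF op_linear_add[OF lin r[of x] r[of y]]] by simp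
  have rscaleC: "r (c *\<^sub>C x) = c *\<^sub>C r x" for c x
    using unique[OF op_linear_scaleC[OF lin r[of x], of c]]
    by (simp add: scaleC_add_right[symmetric])
  have rnorm: "norm (r x) \<le> norm x" for x
    using nonneg_norm_le[OF pos r[of x], of 1] by simp
  have "bounded_linear r"
  proof (rule bounded_linear_intro[where K=1])
    show "r (a *\<^sub>R x) = a *\<^sub>R r x" for a x
      using rscaleC[of "complex_of_real a" x] by (simp add: scaleC_of_real)
  qed (simp_all add: radd rnorm)
  then have ap: "blinfun_apply (Blinfun r) = r" by (rule bounded_linear_Blinfun_apply)
  have "pos_contraction (Blinfun r)"
    unfolding pos_contraction_def ap
  proof (intro conjI allI)
    fix x y
    have "r x \<bullet> (y - r y) = (x - r x) \<bullet> r y"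
      using r[of x] r[of y] unfolding self_adjoint_graph[OF H, of "r x"] by blast
    then show "r x \<bullet> y = x \<bullet> r y" by (simp add: inner_diff_left inner_diff_right)
    have "0 \<le> r x \<bullet> (x - r x)" by (rule op_nonneg_inner[OF pos r])
    then have "r x \<bullet> r x \<le> x \<bullet> r x" by (simp add: inner_diff_right inner_commute)
    then show "0 \<le> x \<bullet> r x" by (meson inner_ge_zero order_trans)
    show "norm (Blinfun r) \<le> 1" by (rule norm_blinfun_bound) (simp_all add: ap rnorm)
  qed
  then show ?thesis
    using r rscaleC by (intro exI[of _ "Blinfun r"]) (auto simp: unit_resolvent_def complex_linear_def ap)
qed

lemma bounded_inverse_eqI:
  fixes B :: "'a::complex_hilbert \<Rightarrow>\<^sub>L 'a"
  assumes 1: "\<And>y. A (B y) = Some y" and 2: "\<And>x y. A x = Some y \<Longrightarrow> B y = x"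
  shows "bounded_inverse A = B"
  unfolding bounded_inverse_def
proof (rule the_equality)
  show "(\<forall>y. A (B y) = Some y) \<and> (\<forall>x\<in>dom A. B (the (A x)) = x)"
    using assms by auto
  fix C :: "'a \<Rightarrow>\<^sub>L 'a"
  assume C: "(\<forall>y. A (C y) = Some y) \<and> (\<forall>x\<in>dom A. C (the (A x)) = x)"
  show "C = B"
  proof (rule blinfun_eqI)
    fix y show "C y = B y" using C 2[of "C y" y] by simp
  qed
qed

text \<open>In terms of \<open>r = 1 / (1 + h)\<close> the number \<open>1 / (1 + t * h)\<close> is the following. At \<open>t = 0\<close> the
  quotient would give \<open>0\<close> instead of \<open>1\<close> for \<open>r = 0\<close>.\<close>

definition resolvent_fun :: "real \<Rightarrow> real \<Rightarrow> real" where
  "resolvent_fun t r = (if t = 0 then 1 else r / (r + t * (1 - r)))"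

lemma resolvent_denominator_pos:
  fixes r t :: real
  assumes "r \<in> {0..1}" "0 < t"
  shows "0 < r + t * (1 - r)"
proof (cases "r = 1")
  case False
  then have "0 < t * (1 - r)" using assms by simp
  then show ?thesis using assms by simp
qed simp

lemma continuous_on_resolvent_fun: "0 \<le> t \<Longrightarrow> continuous_on {0..1} (resolvent_fun t)"
proof (cases "t = 0")
  case True
  then show ?thesis by (simp add: resolvent_fun_def)
next
  case False
  assume "0 \<le> t"
  have "continuous_on {0..1} (\<lambda>r. r / (r + t * (1 - r)))"
  proof (intro continuous_intros ballI)
    show "r + t * (1 - r) \<noteq> 0" if "r \<in> {0..1}" for r
      using resolvent_denominator_pos[OF that, of t] False \<open>0 \<le> t\<close> by simp
  qed
  then show ?thesis using False by (simp add: resolvent_fun_def)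
qed

lemma resolvent_fun_bounds:
  assumes "0 \<le> t"
  shows "resolvent_fun t ` {0..1} \<subseteq> {0..1}"
proof (cases "t = 0")
  case False
  have "r / (r + t * (1 - r)) \<in> {0..1}" if r: "r \<in> {0..1}" for r
  proof -
    have "0 < r + t * (1 - r)" using resolvent_denominator_pos[OF r, of t] False assms by simp
    moreover have "0 \<le> t * (1 - r)" using r assms by simp
    ultimately show ?thesis using r by (simp add: divide_le_eq_1)
  qed
  then show ?thesis using False
    by (simp add: resolvent_fun_def image_subset_iff del: atLeastAtMost_iff)
qed (auto simp: resolvent_fun_def)

lemma inv_one_plus_eq_cfc:
  assumes H: "op_linear H" "op_nonneg H" and R: "unit_resolvent H R" and t: "0 \<le> t"
  shows "inv_one_plus t H = cfc R (resolvent_fun t)"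
proof (cases "t = 0")
  case True
  then have "resolvent_fun t = (\<lambda>_. 1)" by (simp add: resolvent_fun_def fun_eq_iff)
  with True show ?thesis by (simp add: inv_one_plus_def)
next
  case False
  with t have t: "0 < t" by simp
  have Rpos: "pos_contraction R" and HR: "\<And>z. H (R z) = Some (z - R z)"
    using R by (auto simp: unit_resolvent_def)
  define q where "q r = 1 / (r + t * (1 - r))" for r :: real
  have contq: "continuous_on {0..1} q"
    unfolding q_def
    using resolvent_denominator_pos t by (intro continuous_intros ballI) (metis less_irrefl)
  have "cfc R (resolvent_fun t) = cfc R (\<lambda>r. r * q r)"
    using t by (intro cfc_cong) (simp add: resolvent_fun_def q_def)
  also have "\<dots> = R o\<^sub>L cfc R q"
    by (simp add: cfc_mult Rpos contq cfc_id)
  finally have B: "cfc R (resolvent_fun t) = R o\<^sub>L cfc R q" .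
  have "cfc R (\<lambda>r. (r + t * (1 - r)) * q r) = id_blinfun"
  proof -
    have "cfc R (\<lambda>r. (r + t * (1 - r)) * q r) = cfc R (\<lambda>_. 1)"
    proof (rule cfc_cong)
      fix r :: real assume "r \<in> {0..1}"
      from resolvent_denominator_pos[OF this t] show "(r + t * (1 - r)) * q r = 1"
        by (simp add: q_def)
    qed
    then show ?thesis by simp
  qed
  moreover have "cfc R (\<lambda>r. (r + t * (1 - r)) * q r) = (R + t *\<^sub>R (id_blinfun - R)) o\<^sub>L cfc R q"
  proof -
    have "cfc R (\<lambda>r. t * (1 - r)) = t *\<^sub>R (id_blinfun - R)"
      by (subst cfc_scaleR) (simp_all add: cfc_diff cfc_id Rpos continuous_intros)
    then have "cfc R (\<lambda>r. r + t * (1 - r)) = R + t *\<^sub>R (id_blinfun - R)"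
      by (simp add: cfc_add cfc_id Rpos continuous_intros)
    then show ?thesis by (simp add: cfc_mult Rpos contq continuous_intros)
  qed
  ultimately have inv: "(R + t *\<^sub>R (id_blinfun - R)) o\<^sub>L cfc R q = id_blinfun" by simp
  have right: "one_plus t H (cfc R (resolvent_fun t) y) = Some y" for y
  proof -
    have "one_plus t H (cfc R (resolvent_fun t) y)
        = Some (((R + t *\<^sub>R (id_blinfun - R)) o\<^sub>L cfc R q) y)"
      by (simp add: one_plus_def B HR blinfun.bilinear_simps)
    then show ?thesis by (simp add: inv)
  qed
  have "bounded_inverse (one_plus t H) = cfc R (resolvent_fun t)"
  proof (rule bounded_inverse_eqI[OF right])
    fix x y assume xy: "one_plus t H x = Some y"
    define x' where "x' = cfc R (resolvent_fun t) y"
    obtain h where h: "H x = Some h" "y = x + t *\<^sub>R h"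
      using xy by (auto simp: one_plus_def)
    obtain h' where h': "H x' = Some h'" "y = x' + t *\<^sub>R h'"
      using right[of y, folded x'_def] by (auto simp: one_plus_def)
    have "(x' - x) + t *\<^sub>R (h' - h) = 0" using h(2) h'(2) by (simp add: algebra_simps)
    with nonneg_norm_le[OF H(2) op_linear_diff[OF H(1) h'(1) h(1)], of t] t
    show "cfc R (resolvent_fun t) y = x" by (simp add: x'_def)
  qed
  then show ?thesis using t by (simp add: inv_one_plus_def)
qed

section \<open>The semigroup\<close>

text \<open>In terms of \<open>r = 1 / (1 + h)\<close> the number \<open>exp (- t * h)\<close> is the following. The point \<open>r = 0\<close> stands for
  \<open>h = \<infinity>\<close>, and the function is continuous there for each fixed \<open>t\<close>, though not jointly in \<open>t\<close> and \<open>r\<close>.\<close>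

definition exp_fun :: "real \<Rightarrow> real \<Rightarrow> real" where
  "exp_fun t r = (if t = 0 then 1 else if r = 0 then 0 else exp (t * (1 - 1 / r)))"

text \<open>This is \<open>exp (- y) \<le> 1 / (1 + y)\<close>; it yields the continuity of \<open>exp_fun t\<close> at \<open>0\<close>.\<close>

lemma exp_fun_le_resolvent_fun:
  assumes "0 < t" "r \<in> {0..1}"
  shows "exp_fun t r \<le> resolvent_fun t r"
proof (cases "r = 0")
  case False
  with assms have r: "0 < r" "r \<le> 1" by auto
  define y where "y = t * (1 / r - 1)"
  have "0 \<le> y" using r assms by (simp add: y_def)
  have "exp_fun t r = 1 / exp y"
    using assms r by (simp add: exp_fun_def y_def exp_minus[symmetric] inverse_eq_divide[symmetric] algebra_simps)
  also have "\<dots> \<le> 1 / (1 + y)"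
    using \<open>0 \<le> y\<close> exp_ge_add_one_self[of y] by (intro divide_left_mono) auto
  also have "\<dots> = resolvent_fun t r"
    using assms r by (simp add: resolvent_fun_def y_def field_simps)
  finally show ?thesis .
qed (use assms in \<open>simp add: exp_fun_def resolvent_fun_def\<close>)

lemma exp_fun_bounds:
  assumes "0 \<le> t" "r \<in> {0..1}"
  shows "0 \<le> exp_fun t r" "exp_fun t r \<le> 1"
proof -
  show "0 \<le> exp_fun t r" by (simp add: exp_fun_def)
  show "exp_fun t r \<le> 1"
    using assms by (auto simp: exp_fun_def mult_le_0_iff)
qed

lemma exp_fun_image: "0 \<le> t \<Longrightarrow> exp_fun t ` {0..1} \<subseteq> {0..1}"
  using exp_fun_bounds by fastforce

lemma continuous_on_exp_fun: 
  assumes "0 \<le> t"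
  shows "continuous_on {0..1} (exp_fun t)"
proof (cases "t = 0")
  case True
  then show ?thesis by (simp add: exp_fun_def)
next
  case False
  with assms have t: "0 < t" by simp
  show ?thesis
    unfolding continuous_on_eq_continuous_within
  proof
    fix r :: real assume r: "r \<in> {0..1}"
    show "continuous (at r within {0..1}) (exp_fun t)"
    proof (cases "r = 0")
      case True
      have "(exp_fun t \<longlongrightarrow> 0) (at 0 within {0..1})"
      proof (rule tendsto_sandwich[OF _ _ tendsto_const])
        show "\<forall>\<^sub>F x in at 0 within {0..1}. 0 \<le> exp_fun t x"
          "\<forall>\<^sub>F x in at 0 within {0..1}. exp_fun t x \<le> resolvent_fun t x"
          using exp_fun_bounds(1)[of t] exp_fun_le_resolvent_fun[OF t] assms
          by (auto simp: eventually_at_filter intro!: always_eventually)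
        have "continuous (at 0 within {0..1}) (resolvent_fun t)"
          using continuous_on_resolvent_fun[OF assms] by (simp add: continuous_on_eq_continuous_within)
        then show "(resolvent_fun t \<longlongrightarrow> 0) (at 0 within {0..1})"
          using t by (simp add: continuous_within resolvent_fun_def)
      qed
      then show ?thesis using True t by (simp add: continuous_within exp_fun_def)
    next
      case False
      have "isCont (\<lambda>r. exp (t * (1 - 1 / r))) r"
        using False by (intro continuous_intros) auto
      moreover have eq: "\<forall>\<^sub>F x in nhds r. exp (t * (1 - 1 / x)) = exp_fun t x"
        using t False by (intro eventually_nhds_in_open[of "- {0}" r, THEN eventually_mono])
          (auto simp: exp_fun_def)
      ultimately have "isCont (exp_fun t) r" using isCont_cong[OF eq] by simp
      then show ?thesis by (rule continuous_at_imp_continuous_at_within)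
    qed
  qed
qed

lemma exp_fun_add: "0 \<le> s \<Longrightarrow> 0 \<le> t \<Longrightarrow> exp_fun (s + t) r = exp_fun s r * exp_fun t r"
  by (auto simp: exp_fun_def exp_add[symmetric] distrib_right)

text \<open>The elementary bounds on \<open>exp (- y)\<close> behind the strong differentiability of the semigroup. The factors
  \<open>r\<close> absorb the unboundedness of \<open>1 / r - 1\<close>.\<close>

lemma exp_fun_quotient_bounds:
  assumes h: "0 < h" and r: "r \<in> {0..1}"
  shows "\<bar>(exp_fun h r - 1) * r / h\<bar> \<le> 1"
    and "\<bar>(exp_fun h r - 1) * r / h * r - (r - 1) * r\<bar> \<le> h"
proof -
  have "\<bar>(exp_fun h r - 1) * r / h\<bar> \<le> 1 \<and> \<bar>(exp_fun h r - 1) * r / h * r - (r - 1) * r\<bar> \<le> h"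
  proof (cases "r = 0")
    case False
    with r have r: "0 < r" "r \<le> 1" by auto
    define s y where "s = 1 / r - 1" and "y = h * s"
    have s: "0 \<le> s" "s * r = 1 - r" using r by (auto simp: s_def field_simps)
    have y: "0 \<le> y" using s h by (simp add: y_def)
    have E: "exp_fun h r = exp (- y)" using r h by (simp add: exp_fun_def y_def s_def algebra_simps)
    have lower: "- y \<le> exp (- y) - 1" using exp_ge_add_one_self[of "- y"] by simp
    have upper: "exp (- y) - 1 \<le> - y + y * y"
    proof -
      have "exp (- y) \<le> 1 / (1 + y)"
        using y exp_ge_add_one_self[of y]
        by (auto simp: exp_minus inverse_eq_divide intro!: divide_left_mono mult_pos_pos)
      also have "\<dots> \<le> 1 - y + y * y"
      proof -
        have "(1 - y + y * y) * (1 + y) = 1 + y * y * y" by (simp add: algebra_simps)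
        moreover have "0 \<le> y * y * y" using y by simp
        ultimately show ?thesis using y by (subst pos_divide_le_eq) auto
      qed
      finally show ?thesis by simp
    qed
    have "\<bar>exp (- y) - 1\<bar> \<le> y" using lower y by simp
    then have "\<bar>exp (- y) - 1\<bar> * (r / h) \<le> y * (r / h)" using r h by (intro mult_right_mono) auto
    also have "y * (r / h) = s * r" using h by (simp add: y_def)
    also have "\<dots> \<le> 1" using s r by simp
    finally have 1: "\<bar>(exp_fun h r - 1) * r / h\<bar> \<le> 1"
      using r h by (simp add: E abs_mult)
    have "(exp_fun h r - 1) * r / h * r - (r - 1) * r = (exp (- y) - 1 + y) * (r * r / h)"
    proof -
      have "y * (r * r / h) = (s * r) * r" using h by (simp add: y_def)
      also have "\<dots> = - ((r - 1) * r)" unfolding s(2) by (simp add: algebra_simps)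
      finally have q: "y * (r * r / h) = - ((r - 1) * r)" .
      have "(exp_fun h r - 1) * r / h * r = (exp (- y) - 1) * (r * r / h)" by (simp add: E)
      then show ?thesis by (simp only: distrib_right q)
    qed
    also have "\<bar>\<dots>\<bar> \<le> (y * y) * (r * r / h)"
      using lower upper r h by (simp only: abs_mult) (intro mult_mono, auto)
    also have "\<dots> = h * (s * r)\<^sup>2" using h by (simp add: y_def power2_eq_square)
    also have "\<dots> \<le> h * 1\<^sup>2"
      using s r h by (intro mult_left_mono power_mono) auto
    finally show ?thesis using 1 by simp
  qed (use h in auto)
  then show "\<bar>(exp_fun h r - 1) * r / h\<bar> \<le> 1"
    and "\<bar>(exp_fun h r - 1) * r / h * r - (r - 1) * r\<bar> \<le> h" by auto
qed

text \<open>Complex linearity is commutation with multiplication by \<open>\<i>\<close>, so functional calculus preserves it.\<close>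

lemma complex_linear_cfc:
  assumes A: "pos_contraction A" and lin: "complex_linear (A :: 'a::complex_hilbert \<Rightarrow>\<^sub>L 'a)"
    and f: "continuous_on {0..1} f"
  shows "complex_linear (cfc A f)"
proof -
  have norm_i: "norm (\<i> *\<^sub>C x) = norm x" for x :: 'a
  proof -
    have "cinner (\<i> *\<^sub>C x) (\<i> *\<^sub>C x) = \<i> * cnj (\<i> * cinner x x)"
      by (metis cinner_cnj_commute cinner_scaleC_right)
    then have "(\<i> *\<^sub>C x) \<bullet> (\<i> *\<^sub>C x) = x \<bullet> x" by (simp add: inner_eq_Re_cinner)
    then show ?thesis by (simp add: norm_eq_sqrt_inner)
  qed
  have "bounded_linear (\<lambda>x :: 'a. \<i> *\<^sub>C x)"
  proof (rule bounded_linear_intro[where K=1])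
    show "\<i> *\<^sub>C (r *\<^sub>R x) = r *\<^sub>R (\<i> *\<^sub>C x)" for r and x :: 'a
      by (simp only: scaleC_of_real[symmetric] scaleC_scaleC mult.commute)
  qed (simp_all add: scaleC_add_right norm_i)
  then have ap: "blinfun_apply (Blinfun (\<lambda>x :: 'a. \<i> *\<^sub>C x)) = (\<lambda>x. \<i> *\<^sub>C x)"
    by (rule bounded_linear_Blinfun_apply)
  have i: "\<i> *\<^sub>C cfc A f x = cfc A f (\<i> *\<^sub>C x)" for x
    using cfc_commute[OF A f, of "Blinfun (\<lambda>x. \<i> *\<^sub>C x)" x] lin by (simp add: ap complex_linear_def)
  show ?thesis
    unfolding complex_linear_def
  proof (intro allI)
    fix c and x :: 'a
    have split: "c *\<^sub>C z = Re c *\<^sub>R z + Im c *\<^sub>R (\<i> *\<^sub>C z)" for z :: 'a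
    proof -
      have "c *\<^sub>C z = (complex_of_real (Re c) + complex_of_real (Im c) * \<i>) *\<^sub>C z"
        by (simp add: complex_eq_iff[of c] mult.commute flip: complex_eq)
      then show ?thesis by (simp only: scaleC_add_left scaleC_scaleC[symmetric] scaleC_of_real)
    qed
    show "cfc A f (c *\<^sub>C x) = c *\<^sub>C cfc A f x"
      unfolding split[of x] split[of "cfc A f x"] by (simp add: blinfun.bilinear_simps i)
  qed
qed

text \<open>The uniform bound controls the error made by replacing a vector by a nearby one in the dense set.\<close>

lemma strong_tendsto_dense:
  fixes D :: "'b \<Rightarrow> ('a::real_normed_vector \<Rightarrow>\<^sub>L 'a)" and L :: "'a \<Rightarrow>\<^sub>L 'a"
  assumes bound: "\<forall>\<^sub>F h in F. norm (D h) \<le> C" and L: "norm L \<le> C"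
    and dense: "closure X = UNIV" and conv: "\<And>x. x \<in> X \<Longrightarrow> ((\<lambda>h. D h x) \<longlongrightarrow> L x) F"
  shows "((\<lambda>h. D h x) \<longlongrightarrow> L x) F"
proof (rule tendstoI)
  fix e :: real assume e: "0 < e"
  have C: "0 \<le> C" using L norm_ge_zero order_trans by blast
  have "x \<in> closure X" using dense by simp
  then obtain y where y: "y \<in> X" "dist y x < e / (4 * (C + 1))"
    using e C closure_approachable[of x X] by (meson divide_pos_pos add_nonneg_pos mult_pos_pos zero_less_numeral zero_less_one)
  have small: "norm (B (x - y)) < e / 4" if "norm B \<le> C" for B :: "'a \<Rightarrow>\<^sub>L 'a"
  proof -
    have "norm (B (x - y)) \<le> norm B * norm (x - y)" by (rule norm_blinfun)
    also have "\<dots> \<le> (C + 1) * norm (x - y)" using that by (intro mult_right_mono) auto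
    also have "\<dots> < e / 4" using y C by (simp add: dist_norm norm_minus_commute field_simps)
    finally show ?thesis .
  qed
  have "\<forall>\<^sub>F h in F. dist (D h y) (L y) < e / 2"
    using conv[OF y(1)] e by (intro tendstoD) simp_all
  with bound show "\<forall>\<^sub>F h in F. dist (D h x) (L x) < e"
  proof eventually_elim
    case (elim h)
    have "D h x - L x = D h (x - y) + (D h y - L y) - L (x - y)"
      by (simp add: blinfun.bilinear_simps)
    also have "norm \<dots> \<le> norm (D h (x - y)) + norm (D h y - L y) + norm (L (x - y))"
      by (meson norm_triangle_ineq norm_triangle_ineq4 order_trans add_mono order_refl)
    also have "\<dots> < e / 4 + e / 2 + e / 4"
      using small[OF elim(1)] small[OF L] elim(2) by (simp add: dist_norm)
    finally show ?case by (simp add: dist_norm)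
  qed
qed

lemma dom_eq_range_resolvent:
  assumes H: "op_linear H" "op_nonneg H" and R: "unit_resolvent H R"
  shows "dom H = range R"
proof
  show "dom H \<subseteq> range R" using unit_resolvent_inverse[OF H R] by (metis domD rangeI subsetI)
  show "range R \<subseteq> dom H" using R by (auto simp: unit_resolvent_def)
qed

text \<open>On \<open>R z\<close> the difference quotient of \<open>cfc R (exp_fun h)\<close> is a function of \<open>R\<close> applied to \<open>z\<close>. These
  functions are bounded by \<open>1\<close>, and after another multiplication by \<open>r\<close> they converge uniformly.\<close>

lemma semigroup_derivative:
  fixes H :: "'a::complex_hilbert operator"
  assumes H: "op_self_adjoint H" "op_nonneg H" and R: "unit_resolvent H R"
  shows "((\<lambda>h. (1 / h) *\<^sub>R (cfc R (exp_fun h) (R z) - R z)) \<longlongrightarrow> R z - z) (at_right 0)"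
proof -
  have lin: "op_linear H" and dense: "closure (dom H) = UNIV"
    using H by (auto simp: op_self_adjoint_def densely_defined_def)
  have A: "pos_contraction R" using R by (simp add: unit_resolvent_def)
  define \<phi> where "\<phi> h r = (exp_fun h r - 1) * r / h" for h r
  have cont: "continuous_on {0..1} (\<phi> h)" if "0 < h" for h
    using that unfolding \<phi>_def by (intro continuous_intros continuous_on_exp_fun) auto
  have quot: "cfc R (\<phi> h) z = (1 / h) *\<^sub>R (cfc R (exp_fun h) (R z) - R z)" if h: "0 < h" for h z
  proof -
    have c: "continuous_on {0..1} (exp_fun h)" using h by (intro continuous_on_exp_fun) simp
    have "\<phi> h = (\<lambda>r. (1 / h) * ((exp_fun h r - 1) * r))" by (simp add: \<phi>_def fun_eq_iff)
    then have "cfc R (\<phi> h) = (1 / h) *\<^sub>R cfc R (\<lambda>r. (exp_fun h r - 1) * r)"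
      by (simp only:) (intro cfc_scaleR A continuous_intros c)
    also have "cfc R (\<lambda>r. (exp_fun h r - 1) * r) = ((cfc R (exp_fun h) - id_blinfun) o\<^sub>L R)"
      by (simp add: cfc_mult cfc_diff cfc_id A c continuous_intros)
    finally show ?thesis by (simp add: blinfun.bilinear_simps)
  qed
  have ev: "\<forall>\<^sub>F h in at_right 0. 0 < (h::real)"
    by (simp add: eventually_at_filter)
  have nR: "norm (R - id_blinfun) \<le> 1"
  proof -
    have "norm (cfc R (\<lambda>r. r - 1)) \<le> 1"
      by (intro cfc_norm_le A continuous_intros) auto
    then show ?thesis by (simp add: cfc_diff cfc_id A continuous_intros)
  qed
  have "((\<lambda>h. cfc R (\<phi> h) z) \<longlongrightarrow> (R - id_blinfun) z) (at_right 0)"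
  proof (rule strong_tendsto_dense[OF _ nR dense])
    show "\<forall>\<^sub>F h in at_right 0. norm (cfc R (\<phi> h)) \<le> 1"
      using ev
    proof eventually_elim
      case (elim h)
      then show ?case using exp_fun_quotient_bounds(1)[OF elim]
        by (intro cfc_norm_le A cont) (auto simp: \<phi>_def)
    qed
    fix x assume "x \<in> dom H"
    then obtain w where w: "x = R w" using dom_eq_range_resolvent[OF lin H(2) R] by blast
    have le: "norm (cfc R (\<phi> h) (R w) - (R - id_blinfun) (R w)) \<le> h * norm w" if h: "0 < h" for h
    proof -
      have "norm (cfc R (\<lambda>r. \<phi> h r * r) - cfc R (\<lambda>r. (r - 1) * r)) \<le> h"
        using exp_fun_quotient_bounds(2)[OF h]
        by (intro cfc_diff_norm_le A continuous_intros cont h) (auto simp: \<phi>_def)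
      then have *: "norm ((cfc R (\<phi> h) o\<^sub>L R) - ((R - id_blinfun) o\<^sub>L R)) \<le> h"
        by (simp add: cfc_mult cfc_diff cfc_id A cont h continuous_intros)
      have "norm (((cfc R (\<phi> h) o\<^sub>L R) - ((R - id_blinfun) o\<^sub>L R)) w) \<le> h * norm w"
        by (rule order_trans[OF norm_blinfun mult_right_mono[OF *]]) simp
      then show ?thesis by (simp add: blinfun.bilinear_simps)
    qed
    have bound: "\<forall>\<^sub>F h in at_right 0. norm (cfc R (\<phi> h) (R w) - (R - id_blinfun) (R w)) \<le> h * norm w"
      using ev by eventually_elim (rule le)
    have "((\<lambda>h. h * norm w) \<longlongrightarrow> 0 * norm w) (at_right 0)"
      by (intro tendsto_intros)
    then have "((\<lambda>h. h * norm w) \<longlongrightarrow> 0) (at_right 0)" by (simp only: mult_zero_left)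
    then have "((\<lambda>h. cfc R (\<phi> h) (R w) - (R - id_blinfun) (R w)) \<longlongrightarrow> 0) (at_right 0)"
      by (rule Lim_null_comparison[OF bound])
    then show "((\<lambda>h. cfc R (\<phi> h) x) \<longlongrightarrow> (R - id_blinfun) x) (at_right 0)"
      unfolding w by (rule LIM_zero_cancel)
  qed
  then have "((\<lambda>h. cfc R (\<phi> h) z) \<longlongrightarrow> R z - z) (at_right 0)"
    by (simp add: blinfun.bilinear_simps)
  moreover have "\<forall>\<^sub>F h in at_right 0. cfc R (\<phi> h) z = (1 / h) *\<^sub>R (cfc R (exp_fun h) (R z) - R z)"
    using ev by eventually_elim (rule quot)
  ultimately show ?thesis by (rule Lim_transform_eventually)
qed

lemma norm_semigroup_le:
  "pos_contraction R \<Longrightarrow> 0 \<le> t \<Longrightarrow> norm (cfc R (exp_fun t)) \<le> 1"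
  using exp_fun_bounds by (intro cfc_norm_le continuous_on_exp_fun) auto

lemma C0_semigroup_cfc:
  assumes H: "op_self_adjoint H" "op_nonneg H" and R: "unit_resolvent H R"
  shows "C0_semigroup (\<lambda>t. cfc R (exp_fun t))"
  unfolding C0_semigroup_def
proof (intro conjI allI impI)
  have lin: "op_linear H" and dense: "closure (dom H) = UNIV"
    using H by (auto simp: op_self_adjoint_def densely_defined_def)
  have A: "pos_contraction R" and cl: "complex_linear R" using R by (auto simp: unit_resolvent_def)
  show "complex_linear (cfc R (exp_fun t))" if "0 \<le> t" for t
    by (intro complex_linear_cfc A cl continuous_on_exp_fun that)
  have "exp_fun 0 = (\<lambda>_. 1)" by (simp add: exp_fun_def fun_eq_iff)
  then show "cfc R (exp_fun 0) = id_blinfun" by simp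
  show "cfc R (exp_fun (s + t)) = cfc R (exp_fun s) o\<^sub>L cfc R (exp_fun t)" if "0 \<le> s" "0 \<le> t" for s t
  proof -
    have "exp_fun (s + t) = (\<lambda>r. exp_fun s r * exp_fun t r)"
      using that by (simp add: exp_fun_add fun_eq_iff)
    then show ?thesis by (simp add: cfc_mult A continuous_on_exp_fun that)
  qed
  have ev: "\<forall>\<^sub>F h in at_right 0. 0 < (h::real)"
    by (simp add: eventually_at_filter)
  fix x
  have "((\<lambda>t. cfc R (exp_fun t) x) \<longlongrightarrow> id_blinfun x) (at_right 0)"
  proof (rule strong_tendsto_dense[OF _ norm_blinfun_id_le dense])
    show "\<forall>\<^sub>F t in at_right 0. norm (cfc R (exp_fun t)) \<le> 1"
      using ev by eventually_elim (intro norm_semigroup_le A, simp)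
    fix y assume "y \<in> dom H"
    then obtain z where z: "y = R z" using dom_eq_range_resolvent[OF lin H(2) R] by blast
    have "((\<lambda>h. h *\<^sub>R ((1 / h) *\<^sub>R (cfc R (exp_fun h) (R z) - R z))) \<longlongrightarrow> 0 *\<^sub>R (R z - z)) (at_right 0)"
      by (intro tendsto_scaleR semigroup_derivative[OF H R]) (rule tendsto_ident_at)
    then have "((\<lambda>h. h *\<^sub>R ((1 / h) *\<^sub>R (cfc R (exp_fun h) (R z) - R z))) \<longlongrightarrow> 0) (at_right 0)"
      by simp
    then have "((\<lambda>h. cfc R (exp_fun h) (R z) - R z) \<longlongrightarrow> 0) (at_right 0)"
      by (rule Lim_transform_eventually) (use ev in eventually_elim, simp)
    then show "((\<lambda>h. cfc R (exp_fun h) y) \<longlongrightarrow> id_blinfun y) (at_right 0)"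
      unfolding z by (simp add: LIM_zero_cancel)
  qed
  then show "((\<lambda>t. cfc R (exp_fun t) x) \<longlongrightarrow> x) (at_right 0)" by simp
qed

lemma generator_eqI:
  fixes T :: "real \<Rightarrow> ('a::complex_hilbert \<Rightarrow>\<^sub>L 'a)"
  assumes "((\<lambda>h. (1 / h) *\<^sub>R (T h x - x)) \<longlongrightarrow> y) (at_right 0)"
  shows "generator T x = Some y"
  unfolding generator_def using assms tendsto_Lim[OF _ assms] by auto

lemma generator_tendsto:
  fixes T :: "real \<Rightarrow> ('a::complex_hilbert \<Rightarrow>\<^sub>L 'a)"
  assumes "generator T x = Some y"
  shows "((\<lambda>h. (1 / h) *\<^sub>R (T h x - x)) \<longlongrightarrow> y) (at_right 0)"
proof -
  obtain y' where y': "((\<lambda>h. (1 / h) *\<^sub>R (T h x - x)) \<longlongrightarrow> y') (at_right 0)"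
    using assms unfolding generator_def by (auto split: if_splits)
  then show ?thesis using generator_eqI[OF y'] assms by simp
qed

text \<open>The generator extends \<open>- H\<close>; it cannot be a proper extension, because \<open>1 + H\<close> is already onto while
  the generator \<open>G\<close> of a contraction semigroup satisfies \<open>v \<bullet> G v \<le> 0\<close>, so that \<open>1 - G\<close> is injective.\<close>

lemma generator_cfc:
  fixes H :: "'a::complex_hilbert operator"
  assumes H: "op_self_adjoint H" "op_nonneg H" and R: "unit_resolvent H R"
  shows "generator (\<lambda>t. cfc R (exp_fun t)) = op_uminus H"
proof
  fix x
  let ?T = "\<lambda>t. cfc R (exp_fun t)"
  have lin: "op_linear H" using H by (auto simp: op_self_adjoint_def)
  have A: "pos_contraction R" and HR: "\<And>z. H (R z) = Some (z - R z)"
    using R by (auto simp: unit_resolvent_def)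
  have gen: "generator ?T (R z) = Some (R z - z)" for z
    by (rule generator_eqI[OF semigroup_derivative[OF H R]])
  show "generator ?T x = op_uminus H x"
  proof (cases "x \<in> range R")
    case True
    then show ?thesis using gen HR by (auto simp: op_uminus_def)
  next
    case False
    have "generator ?T x = None"
    proof (rule ccontr)
      assume "generator ?T x \<noteq> None"
      then obtain y where y: "generator ?T x = Some y" by blast
      define w v where "w = R (x - y)" and "v = x - w"
      have "((\<lambda>h. (1 / h) *\<^sub>R (?T h x - x) - (1 / h) *\<^sub>R (?T h w - w)) \<longlongrightarrow> y - (w - (x - y))) (at_right 0)"
        unfolding w_def by (intro tendsto_diff generator_tendsto[OF y] generator_tendsto[OF gen])
      then have "((\<lambda>h. (1 / h) *\<^sub>R (?T h v - v)) \<longlongrightarrow> v) (at_right 0)"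
        by (simp add: v_def blinfun.bilinear_simps scaleR_diff_right algebra_simps)
      then have "((\<lambda>h. v \<bullet> ((1 / h) *\<^sub>R (?T h v - v))) \<longlongrightarrow> v \<bullet> v) (at_right 0)"
        by (intro tendsto_intros)
      moreover have "\<forall>\<^sub>F h in at_right 0. v \<bullet> ((1 / h) *\<^sub>R (?T h v - v)) \<le> 0"
      proof (rule eventually_mono)
        show "\<forall>\<^sub>F h in at_right 0. 0 < (h::real)" by (simp add: eventually_at_filter)
        fix h :: real assume h: "0 < h"
        have "v \<bullet> ?T h v \<le> norm v * norm (?T h v)" by (rule norm_cauchy_schwarz)
        also have "\<dots> \<le> norm v * (1 * norm v)"
          using h by (intro mult_left_mono order_trans[OF norm_blinfun] mult_right_mono norm_semigroup_le A) auto
        finally have "v \<bullet> (?T h v - v) \<le> 0"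
          by (simp add: inner_diff_right dot_square_norm power2_eq_square)
        then show "v \<bullet> ((1 / h) *\<^sub>R (?T h v - v)) \<le> 0"
          using h by (simp add: divide_le_0_iff)
      qed
      ultimately have "v \<bullet> v \<le> 0"
        by (rule tendsto_upperbound) simp
      then have "v = 0" by (metis inner_eq_zero_iff inner_ge_zero order_antisym)
      then show False using False by (simp add: v_def w_def)
    qed
    moreover have "H x = None"
      using False dom_eq_range_resolvent[OF lin H(2) R] by blast
    ultimately show ?thesis by (simp add: op_uminus_def)
  qed
qed

section \<open>Uniqueness of the semigroup with a given generator\<close>

text \<open>By Baire's theorem one of the closed sets on which all \<open>f n\<close> are bounded by a given \<open>k\<close> contains a ball.\<close>

lemma uniform_boundedness:
  fixes f :: "nat \<Rightarrow> ('a::banach \<Rightarrow>\<^sub>L 'b::real_normed_vector)"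
  assumes pw: "\<And>x. \<exists>K. \<forall>n. norm (f n x) \<le> K"
  shows "\<exists>K. \<forall>n. norm (f n) \<le> K"
proof -
  define E where "E k = {x. \<forall>n. norm (f n x) \<le> real k}" for k
  have cl: "closed (E k)" for k
  proof -
    have "E k = (\<Inter>n. {x. norm (f n x) \<le> real k})" by (auto simp: E_def)
    then show ?thesis by (auto intro!: closed_INT closed_Collect_le continuous_intros)
  qed
  have "\<Union>(range E) = UNIV"
  proof -
    have "x \<in> \<Union>(range E)" for x
    proof -
      obtain K where K: "\<forall>n. norm (f n x) \<le> K" using pw by blast
      have "norm (f n x) \<le> real (nat \<lceil>K\<rceil>)" for n
        using K[rule_format, of n] real_nat_ceiling_ge[of K] by linarith
      then show ?thesis by (auto simp: E_def)
    qed
    then show ?thesis by blast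
  qed
  moreover have "interior (\<Union>(range E)) = {}" if "\<And>k. interior (E k) = {}"
    using Baire_category_alt[of "euclidean :: 'a topology" "range E"] that cl
    by (auto simp: completely_metrizable_space_euclidean interior_of_def interior_def closed_closedin[symmetric])
  ultimately obtain k where "interior (E k) \<noteq> {}" by (metis UNIV_not_empty interior_UNIV)
  then obtain x0 where x0: "x0 \<in> interior (E k)" by blast
  then obtain e where e: "0 < e" "cball x0 e \<subseteq> E k" by (meson mem_interior_cball)
  have "norm (f n) \<le> 2 * real k / e" for n
  proof (rule norm_blinfun_bound)
    show "0 \<le> 2 * real k / e" using e by simp
    fix y
    show "norm (f n y) \<le> 2 * real k / e * norm y"
    proof (cases "y = 0")
      case False
      define s where "s = e / norm y"
      have s: "0 < s" using e False by (simp add: s_def)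
      have "x0 + s *\<^sub>R y \<in> E k"
        using e False by (intro subsetD[OF e(2)]) (simp add: dist_norm s_def)
      moreover have "x0 \<in> E k" using x0 interior_subset by blast
      ultimately have "norm (f n (x0 + s *\<^sub>R y)) \<le> real k" "norm (f n x0) \<le> real k"
        by (auto simp: E_def)
      moreover have "s *\<^sub>R f n y = f n (x0 + s *\<^sub>R y) - f n x0"
        by (simp add: blinfun.bilinear_simps)
      ultimately have "norm (s *\<^sub>R f n y) \<le> 2 * real k"
        using norm_triangle_ineq4[of "f n (x0 + s *\<^sub>R y)" "f n x0"] by simp
      then show ?thesis using s e False by (simp add: s_def field_simps)
    qed simp
  qed
  then show ?thesis by blast
qed

text \<open>If the norms were unbounded near \<open>0\<close>, they would be so along a sequence of times tending to \<open>0\<close>, although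
  every orbit converges along it.\<close>

lemma C0_semigroup_locally_bounded:
  fixes T :: "real \<Rightarrow> ('a::complex_hilbert \<Rightarrow>\<^sub>L 'a)"
  assumes T: "C0_semigroup T"
  shows "\<exists>d>0. \<exists>M. \<forall>t. 0 \<le> t \<and> t \<le> d \<longrightarrow> norm (T t) \<le> M"
proof (rule ccontr)
  assume contra: "\<not> ?thesis"
  have "\<exists>t. 0 \<le> t \<and> t \<le> 1 / real (Suc n) \<and> \<not> norm (T t) \<le> real n" for n
    using contra by (metis of_nat_0_less_iff zero_less_Suc zero_less_divide_1_iff)
  then obtain t where t: "\<And>n. 0 \<le> t n" "\<And>n. t n \<le> 1 / real (Suc n)" "\<And>n. \<not> norm (T (t n)) \<le> real n"
    by metis
  have t0: "t \<longlonglongrightarrow> 0"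
  proof (rule tendsto_sandwich[OF _ _ tendsto_const])
    show "(\<lambda>n. 1 / real (Suc n)) \<longlonglongrightarrow> 0"
      using LIMSEQ_inverse_real_of_nat by (simp add: inverse_eq_divide)
  qed (use t in auto)
  have "\<exists>K. \<forall>n. norm (T (t n) x) \<le> K" for x
  proof -
    have "((\<lambda>s. T s x) \<longlongrightarrow> T 0 x) (at 0 within {0..})"
    proof -
      have "((\<lambda>s. T s x) \<longlongrightarrow> x) (at_right 0)" "T 0 = id_blinfun"
        using T by (auto simp: C0_semigroup_def)
      moreover have "at 0 within {0..} = at_right (0::real)"
        by (auto simp: at_within_def intro!: arg_cong2[where f=inf] arg_cong[where f=principal])
      ultimately show ?thesis by simp
    qed
    then have "continuous (at 0 within {0..}) (\<lambda>s. T s x)" by (simp add: continuous_within)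
    then have "(\<lambda>n. T (t n) x) \<longlonglongrightarrow> T 0 x"
      using t0 t(1) by (auto simp: continuous_within_sequentially o_def)
    then have "Bseq (\<lambda>n. T (t n) x)" by (rule convergent_imp_Bseq[OF convergentI])
    then show ?thesis by (auto simp: Bseq_def)
  qed
  then obtain K where K: "\<forall>n. norm (T (t n)) \<le> K" using uniform_boundedness[of "\<lambda>n. T (t n)"] by blast
  obtain n where "K \<le> real n" using real_arch_simple by blast
  then show False using t(3)[of n] K by (meson order_trans)
qed

lemma bpower_commute:
  fixes A B :: "'a::real_normed_vector \<Rightarrow>\<^sub>L 'a"
  assumes "\<And>x. B (A x) = A (B x)"
  shows "B (bpower A n x) = bpower A n (B x)"
  by (induction n) (simp_all add: assms)

text \<open>Telescoping: \<open>A^n - B^n\<close> is the sum of the terms \<open>B^(n-1-k) A^k (A - B)\<close>.\<close>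

lemma bpower_diff_le:
  fixes A B :: "'a::real_normed_vector \<Rightarrow>\<^sub>L 'a"
  assumes comm: "\<And>x. A (B x) = B (A x)" and B: "norm B \<le> 1"
    and A: "\<And>k. k < n \<Longrightarrow> norm (bpower A k) \<le> M"
  shows "norm (bpower A n x - bpower B n x) \<le> real n * (M * norm (A x - B x))"
  using A
proof (induction n)
  case (Suc n)
  have "bpower A (Suc n) x - bpower B (Suc n) x
      = bpower A n (A x - B x) + B (bpower A n x - bpower B n x)"
  proof -
    have "A (bpower A n x) = bpower A n (A x)" by (rule bpower_commute) simp
    moreover have "B (bpower A n x) = bpower A n (B x)" by (rule bpower_commute) (simp add: comm)
    ultimately show ?thesis by (simp add: blinfun.bilinear_simps)
  qed
  also have "norm \<dots> \<le> norm (bpower A n) * norm (A x - B x) + norm B * norm (bpower A n x - bpower B n x)"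
    by (intro norm_triangle_le add_mono norm_blinfun)
  also have "\<dots> \<le> M * norm (A x - B x) + 1 * (real n * (M * norm (A x - B x)))"
  proof -
    have "norm (bpower A n) \<le> M" by (rule Suc.prems) simp
    moreover have "norm (bpower A n x - bpower B n x) \<le> real n * (M * norm (A x - B x))"
      by (rule Suc.IH) (simp add: Suc.prems)
    moreover have "0 \<le> M" using Suc.prems[of n] norm_ge_zero[of "bpower A n"] by linarith
    ultimately show ?thesis by (intro add_mono mult_mono B order_refl) auto
  qed
  also have "\<dots> = real (Suc n) * (M * norm (A x - B x))" by (simp add: algebra_simps)
  finally show ?case .
qed simp

lemma C0_semigroup_bpower:
  assumes "C0_semigroup T" "0 \<le> h"
  shows "T (real n * h) = bpower (T h) n"
proof (induction n)
  case 0
  then show ?case using assms by (simp add: C0_semigroup_def)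
next
  case (Suc n)
  have "T (real (Suc n) * h) = T (h + real n * h)" by (simp add: algebra_simps)
  also have "\<dots> = T h o\<^sub>L T (real n * h)" using assms by (simp add: C0_semigroup_def)
  finally show ?case by (simp add: Suc)
qed

text \<open>A semigroup commutes with its generator, hence with the resolvent.\<close>

lemma semigroup_commutes_resolvent:
  fixes H :: "'a::complex_hilbert operator"
  assumes H: "op_linear H" "op_nonneg H" and R: "unit_resolvent H R"
    and T: "C0_semigroup T" and gen: "generator T = op_uminus H" and h: "0 \<le> h"
  shows "T h (R z) = R (T h z)"
proof -
  have "H (R z) = Some (z - R z)" using R by (simp add: unit_resolvent_def)
  then have "generator T (R z) = Some (R z - z)" by (simp add: gen op_uminus_def)
  from generator_tendsto[OF this]
  have "((\<lambda>s. T h ((1 / s) *\<^sub>R (T s (R z) - R z))) \<longlongrightarrow> T h (R z - z)) (at_right 0)"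
    by (intro blinfun.tendsto tendsto_const)
  then have "((\<lambda>s. (1 / s) *\<^sub>R (T s (T h (R z)) - T h (R z))) \<longlongrightarrow> T h (R z - z)) (at_right 0)"
  proof (rule Lim_transform_eventually)
    have "\<forall>\<^sub>F s in at_right 0. 0 < (s::real)" by (simp add: eventually_at_filter)
    then show "\<forall>\<^sub>F s in at_right 0. T h ((1 / s) *\<^sub>R (T s (R z) - R z))
        = (1 / s) *\<^sub>R (T s (T h (R z)) - T h (R z))"
    proof eventually_elim
      case (elim s)
      then have "T (h + s) = T h o\<^sub>L T s" "T (s + h) = T s o\<^sub>L T h"
        using T h by (auto simp: C0_semigroup_def)
      then have "T h (T s (R z)) = T s (T h (R z))"
        by (metis add.commute blinfun_apply_blinfun_compose)
      then show ?case by (simp add: blinfun.bilinear_simps)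
    qed
  qed
  from generator_eqI[OF this] have "H (T h (R z)) = Some (T h z - T h (R z))"
    by (auto simp: gen op_uminus_def blinfun.bilinear_simps) (metis minus_diff_eq minus_minus)
  from unit_resolvent_inverse[OF H R this] show ?thesis by simp
qed

text \<open>On the common domain both semigroups have the same derivative at \<open>0\<close>, so over \<open>n\<close> steps of length
  \<open>t / n\<close> the telescoped difference is \<open>n * o (t / n)\<close>.\<close>

lemma semigroup_unique:
  fixes H :: "'a::complex_hilbert operator"
  assumes H: "op_self_adjoint H" "op_nonneg H" and R: "unit_resolvent H R"
    and T: "C0_semigroup T" and gen: "generator T = op_uminus H" and t: "0 \<le> t"
  shows "T t = cfc R (exp_fun t)"
proof -
  let ?S = "\<lambda>t. cfc R (exp_fun t)"
  have lin: "op_linear H" and dense: "closure (dom H) = UNIV"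
    using H by (auto simp: op_self_adjoint_def densely_defined_def)
  have A: "pos_contraction R" using R by (auto simp: unit_resolvent_def)
  have S: "C0_semigroup ?S" and genS: "generator ?S = op_uminus H"
    by (rule C0_semigroup_cfc[OF H R], rule generator_cfc[OF H R])
  obtain d M where d: "0 < d" and M: "\<And>t. 0 \<le> t \<Longrightarrow> t \<le> d \<Longrightarrow> norm (T t) \<le> M"
    using C0_semigroup_locally_bounded[OF T] by blast
  have comm: "T h (?S s x) = ?S s (T h x)" if "0 \<le> h" "0 \<le> s" for h s x
    using semigroup_commutes_resolvent[OF lin H(2) R T gen that(1)]
    by (intro cfc_commute A continuous_on_exp_fun that(2)) auto
  have small: "T t = ?S t" if t: "0 < t" "t \<le> d" for t
  proof -
    have "T t x = ?S t x" if x: "x \<in> dom H" for x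
    proof -
      obtain y where "op_uminus H x = Some y" using x by (auto simp: op_uminus_def)
      then have y: "generator T x = Some y" "generator ?S x = Some y" by (simp_all add: gen genS)
      have "((\<lambda>h. (1 / h) *\<^sub>R (T h x - x) - (1 / h) *\<^sub>R (?S h x - x)) \<longlongrightarrow> y - y) (at_right 0)"
        by (intro tendsto_diff generator_tendsto y)
      then have lim: "((\<lambda>h. (1 / h) *\<^sub>R (T h x - ?S h x)) \<longlongrightarrow> 0) (at_right 0)"
        by (simp add: scaleR_diff_right)
      have "filterlim (\<lambda>n. t / real (Suc n)) (at_right 0) sequentially"
      proof (rule tendsto_imp_filterlim_at_right)
        have "(\<lambda>n. t * inverse (real (Suc n))) \<longlonglongrightarrow> t * 0"
          by (intro tendsto_mult_left LIMSEQ_inverse_real_of_nat)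
        then show "(\<lambda>n. t / real (Suc n)) \<longlonglongrightarrow> 0" by (simp add: divide_inverse)
      qed (use t in simp)
      from filterlim_compose[OF lim this]
      have "(\<lambda>n. t * (M * norm ((1 / (t / real (Suc n))) *\<^sub>R (T (t / real (Suc n)) x - ?S (t / real (Suc n)) x))))
          \<longlonglongrightarrow> t * (M * norm (0::'a))"
        by (intro tendsto_mult_left tendsto_norm)
      then have lim0: "(\<lambda>n. t * (M * norm ((1 / (t / real (Suc n))) *\<^sub>R (T (t / real (Suc n)) x - ?S (t / real (Suc n)) x))))
          \<longlonglongrightarrow> 0" by simp
      have "norm (T t x - ?S t x)
          \<le> t * (M * norm ((1 / (t / real (Suc n))) *\<^sub>R (T (t / real (Suc n)) x - ?S (t / real (Suc n)) x)))" for n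
      proof -
        define h where "h = t / real (Suc n)"
        have h: "0 < h" "real (Suc n) * h = t" using t by (auto simp: h_def)
        have "norm (bpower (T h) (Suc n) x - bpower (?S h) (Suc n) x)
            \<le> real (Suc n) * (M * norm (T h x - ?S h x))"
        proof (rule bpower_diff_le)
          show "T h (?S h x) = ?S h (T h x)" for x using h by (intro comm) auto
          show "norm (?S h) \<le> 1" using h by (intro norm_semigroup_le A) simp
          fix k assume "k < Suc n"
          then have "real k * h \<le> real (Suc n) * h" using h by (intro mult_right_mono) auto
          then have "real k * h \<le> d" unfolding h(2) using t by linarith
          then have "norm (T (real k * h)) \<le> M" using h by (intro M) auto
          then show "norm (bpower (T h) k) \<le> M" using C0_semigroup_bpower[OF T] h by simp
        qed
        moreover have "bpower (T h) (Suc n) = T t" "bpower (?S h) (Suc n) = ?S t"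
          using C0_semigroup_bpower[OF T, of h "Suc n"] C0_semigroup_bpower[OF S, of h "Suc n"] h by auto
        moreover have "real (Suc n) * (M * norm (T h x - ?S h x))
            = t * (M * norm ((1 / h) *\<^sub>R (T h x - ?S h x)))"
        proof -
          have "norm ((1 / h) *\<^sub>R (T h x - ?S h x)) = norm (T h x - ?S h x) / h"
            using h by (simp only: norm_scaleR) simp
          then have "norm (T h x - ?S h x) = h * norm ((1 / h) *\<^sub>R (T h x - ?S h x))"
            using h by simp
          then show ?thesis by (metis h(2) mult.assoc mult.left_commute)
        qed
        ultimately show ?thesis unfolding h_def[symmetric] by (simp only:)
      qed
      then have "norm (T t x - ?S t x) \<le> 0"
        using lim0 by (intro LIMSEQ_le_const) auto
      then show ?thesis by simp
    qed
    then have "dom H \<subseteq> {x. T t x = ?S t x}" by blast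
    then have "closure (dom H) \<subseteq> {x. T t x = ?S t x}"
      by (intro closure_minimal closed_Collect_eq continuous_intros) auto
    then show ?thesis using dense by (intro blinfun_eqI) blast
  qed
  show ?thesis
  proof (cases "t = 0")
    case True
    then show ?thesis using S T by (simp add: C0_semigroup_def)
  next
    case False
    obtain n where n: "t / d < real (Suc n)" by (metis reals_Archimedean2 less_trans of_nat_less_iff lessI)
    define h where "h = t / real (Suc n)"
    have h: "0 < h" "h \<le> d" "real (Suc n) * h = t"
      using False t n d by (auto simp: h_def field_simps)
    have "T t = bpower (T h) (Suc n)" "?S t = bpower (?S h) (Suc n)"
      using C0_semigroup_bpower[OF T, of h "Suc n"] C0_semigroup_bpower[OF S, of h "Suc n"] h by auto
    then show ?thesis using small[OF h(1,2)] by simp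
  qed
qed

lemma exp_neg_eq_cfc:
  assumes H: "op_self_adjoint H" "op_nonneg H" and R: "unit_resolvent H R" and t: "0 \<le> t"
  shows "exp_neg t H = cfc R (exp_fun t)"
  unfolding exp_neg_def
proof (rule the_equality)
  show "\<exists>T. C0_semigroup T \<and> generator T = op_uminus H \<and> cfc R (exp_fun t) = T t"
    by (intro exI[of _ "\<lambda>t. cfc R (exp_fun t)"] conjI C0_semigroup_cfc[OF H R] generator_cfc[OF H R] refl)
  show "B = cfc R (exp_fun t)" if "\<exists>T. C0_semigroup T \<and> generator T = op_uminus H \<and> B = T t" for B
    using that semigroup_unique[OF H R _ _ t] by blast
qed

section \<open>Powers, exponentials and resolvents of a single contraction\<close>

text \<open>With \<open>n = Suc m\<close> and \<open>u = 1 - f\<close> the difference is at most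
  \<open>n * exp (- (n - 1) * u) * u^2\<close>, and \<open>y^2 * exp (- y)\<close> is bounded.\<close>

lemma power_near_exp:
  fixes f :: real
  assumes f: "f \<in> {0..1}" and m: "0 < m"
  shows "\<bar>f ^ Suc m - exp (- (real (Suc m) * (1 - f)))\<bar> \<le> 4 / real m"
proof -
  define u a where "u = 1 - f" and "a = exp (- u)"
  have u: "0 \<le> u" "f = 1 - u" using f by (auto simp: u_def)
  have fa: "f \<le> a" using exp_ge_add_one_self[of "- u"] by (simp add: a_def u)
  have af: "a - f \<le> u * u"
  proof -
    have "a \<le> 1 / (1 + u)"
      using u exp_ge_add_one_self[of u]
      by (auto simp: a_def exp_minus inverse_eq_divide intro!: divide_left_mono mult_pos_pos)
    also have "\<dots> \<le> 1 - u + u * u"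
    proof -
      have "(1 - u + u * u) * (1 + u) = 1 + u * u * u" by (simp add: algebra_simps)
      moreover have "0 \<le> u * u * u" using u by simp
      ultimately show ?thesis using u by (subst pos_divide_le_eq) auto
    qed
    finally show ?thesis by (simp add: u)
  qed
  have pow: "a ^ Suc k - f ^ Suc k \<le> real (Suc k) * (a ^ k * (a - f))" for k
  proof (induction k)
    case (Suc k)
    have "a ^ Suc (Suc k) - f ^ Suc (Suc k) = a ^ Suc k * (a - f) + f * (a ^ Suc k - f ^ Suc k)"
      by (simp add: algebra_simps)
    also have "f * (a ^ Suc k - f ^ Suc k) \<le> a * (real (Suc k) * (a ^ k * (a - f)))"
      using f fa Suc.IH by (intro mult_mono) (auto intro!: power_mono simp: diff_ge_0_iff_ge simp del: power_Suc)
    finally show ?case by (simp add: algebra_simps)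
  qed simp
  have "a ^ m * (u * u) * (real m * real m) \<le> 2"
  proof -
    define y where "y = real m * u"
    have "0 \<le> y" using u by (simp add: y_def)
    then have "y * y / 2 \<le> exp y"
      using exp_lower_Taylor_quadratic[of y] by (simp add: power2_eq_square)
    then have "exp (- y) * (y * y) \<le> 2" by (simp add: exp_minus field_simps)
    moreover have "a ^ m = exp (- y)"
      by (simp add: a_def y_def exp_of_nat_mult[symmetric])
    ultimately show ?thesis by (simp add: y_def mult_ac)
  qed
  then have am: "a ^ m * (u * u) \<le> 2 / (real m * real m)"
    using m by (simp add: field_simps)
  have "a ^ Suc m - f ^ Suc m \<le> real (Suc m) * (a ^ m * (a - f))" by (rule pow)
  also have "\<dots> \<le> real (Suc m) * (a ^ m * (u * u))"
    by (intro mult_left_mono af) (auto simp: a_def)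
  also have "\<dots> \<le> (2 * real m) * (2 / (real m * real m))"
    using m u by (intro mult_mono am) (auto simp: a_def)
  also have "\<dots> = 4 / real m" by simp
  finally have "a ^ Suc m - f ^ Suc m \<le> 4 / real m" .
  moreover have "f ^ Suc m \<le> a ^ Suc m" using fa f by (intro power_mono) auto
  moreover have "a ^ Suc m = exp (- (real (Suc m) * (1 - f)))"
    unfolding a_def u_def by (simp only: exp_of_nat_mult[symmetric] mult_minus_right)
  ultimately show ?thesis by linarith
qed

text \<open>The continuous function with \<open>resolvent_of_exp (exp (- h)) = 1 / (1 + h)\<close>.\<close>

definition resolvent_of_exp :: "real \<Rightarrow> real" where
  "resolvent_of_exp y = (if y = 0 then 0 else 1 / (1 - ln y))"

lemma continuous_on_resolvent_of_exp: "continuous_on {0..1} resolvent_of_exp"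
  unfolding continuous_on_eq_continuous_within
proof
  fix y :: real assume y: "y \<in> {0..1}"
  show "continuous (at y within {0..1}) resolvent_of_exp"
  proof (cases "y = 0")
    case True
    have "filterlim (\<lambda>y. - ln y) at_top (at_right (0::real))"
      using ln_at_0 by (simp add: filterlim_uminus_at_top)
    then have "filterlim (\<lambda>y. 1 + - ln y) at_top (at_right (0::real))"
      by (intro filterlim_tendsto_add_at_top[OF tendsto_const])
    then have "((\<lambda>y. inverse (1 + - ln y)) \<longlongrightarrow> 0) (at_right (0::real))"
      by (rule tendsto_inverse_0_at_top)
    moreover have "\<forall>\<^sub>F y in at_right (0::real). inverse (1 + - ln y) = resolvent_of_exp y"
      by (auto simp: eventually_at_filter resolvent_of_exp_def inverse_eq_divide intro!: always_eventually)
    ultimately have "(resolvent_of_exp \<longlongrightarrow> 0) (at_right 0)" by (rule Lim_transform_eventually)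
    then show ?thesis using True
      by (simp add: continuous_within at_within_Icc_at_right resolvent_of_exp_def)
  next
    case False
    with y have "ln y \<le> 0" by (auto simp: ln_le_zero_iff)
    then have "1 - ln y \<noteq> 0" by linarith
    then have "isCont (\<lambda>y. 1 / (1 - ln y)) y" using False by (intro continuous_intros)
    moreover have eq: "\<forall>\<^sub>F x in nhds y. 1 / (1 - ln x) = resolvent_of_exp x"
      using False by (intro eventually_nhds_in_open[of "- {0}" y, THEN eventually_mono])
        (auto simp: resolvent_of_exp_def)
    ultimately have "isCont resolvent_of_exp y" using isCont_cong[OF eq] by simp
    then show ?thesis by (rule continuous_at_imp_continuous_at_within)
  qed
qed

text \<open>For \<open>f > 0\<close> put \<open>u = n * (1 - f)\<close> and \<open>L = - n * ln f\<close>. The elementary inequality \<open>ln x \<le> x - 1\<close> at \<open>f\<close> and at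
  \<open>1 / f\<close> gives \<open>0 \<le> n * (L - u) \<le> u * L\<close>, and the difference is \<open>(L - u) / ((1 + u) * (1 + L))\<close>.\<close>

lemma resolvent_near_resolvent_of_power:
  fixes f :: real
  assumes f: "f \<in> {0..1}" and n: "0 < n"
  shows "\<bar>1 / (1 + real n * (1 - f)) - resolvent_of_exp (f ^ n)\<bar> \<le> 1 / real n"
proof (cases "f = 0")
  case True
  then show ?thesis using n by (simp add: resolvent_of_exp_def frac_le)
next
  case False
  with f have f: "0 < f" "f \<le> 1" by auto
  define u L where "u = real n * (1 - f)" and "L = real n * (- ln f)"
  have n0: "0 < real n" using n by simp
  have u0: "0 \<le> u" using f by (simp add: u_def)
  have uL: "u \<le> L"
    unfolding u_def L_def using ln_le_minus_one[OF f(1)] n0 by (intro mult_left_mono) auto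
  have "f * (- ln f) \<le> 1 - f"
    using ln_le_minus_one[of "1 / f"] f by (simp add: ln_div field_simps)
  then have "- ln f - (1 - f) \<le> (1 - f) * (- ln f)" by (simp add: algebra_simps)
  then have "real n * (real n * (- ln f - (1 - f))) \<le> real n * (real n * ((1 - f) * (- ln f)))"
    using n0 by (intro mult_left_mono) auto
  then have Lu: "real n * (L - u) \<le> u * L" by (simp add: u_def L_def algebra_simps)
  have pos: "0 < 1 + u" "0 < 1 + L" using u0 uL by auto
  have "resolvent_of_exp (f ^ n) = 1 / (1 + L)"
    using f by (simp add: resolvent_of_exp_def L_def ln_realpow)
  then have "1 / (1 + real n * (1 - f)) - resolvent_of_exp (f ^ n) = 1 / (1 + u) - 1 / (1 + L)"
    by (simp add: u_def)
  also have "\<dots> = (L - u) / ((1 + u) * (1 + L))" using pos by (simp add: field_simps)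
  finally have "1 / (1 + real n * (1 - f)) - resolvent_of_exp (f ^ n) = (L - u) / ((1 + u) * (1 + L))" .
  moreover have "0 \<le> (L - u) / ((1 + u) * (1 + L))" using pos uL by simp
  moreover have "(L - u) / ((1 + u) * (1 + L)) \<le> 1 / real n"
  proof -
    have "real n * (L - u) \<le> (1 + u) * (1 + L)"
      using Lu u0 uL by (simp add: algebra_simps)
    then show ?thesis using pos n0 by (simp add: pos_divide_le_eq pos_le_divide_eq mult.commute)
  qed
  ultimately show ?thesis by linarith
qed

lemma bpower_eq_cfc:
  assumes A: "pos_contraction A"
  shows "bpower A n = cfc A (\<lambda>x. x ^ n)"
  by (induction n) (simp_all add: cfc_mult cfc_id A continuous_intros)

text \<open>For \<open>\<tau> = t / n\<close> and \<open>S = (1 - F) / \<tau>\<close> one has \<open>t * S = n * (1 - F)\<close>, so this function of \<open>F\<close> is \<open>(1 + t * S)^-1\<close>. In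
  this form it also makes sense for \<open>t = 0\<close>.\<close>

definition scaled_resolvent_fun :: "nat \<Rightarrow> real \<Rightarrow> real" where
  "scaled_resolvent_fun n f = 1 / (1 + real n * (1 - f))"

lemma scaled_resolvent_fun:
  shows "continuous_on {0..1} (scaled_resolvent_fun n)" "scaled_resolvent_fun n ` {0..1} \<subseteq> {0..1}"
proof -
  have pos: "1 \<le> 1 + real n * (1 - f)" if "f \<in> {0..1}" for f using that by simp
  show "continuous_on {0..1} (scaled_resolvent_fun n)"
    unfolding scaled_resolvent_fun_def using pos
    by (intro continuous_intros ballI) (metis less_numeral_extra(3) linorder_not_less zero_less_one)
  show "scaled_resolvent_fun n ` {0..1} \<subseteq> {0..1}"
    using pos by (force simp: scaled_resolvent_fun_def divide_le_eq_1)
qed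

text \<open>By multiplicativity \<open>B\<close> is the two-sided inverse of \<open>1 + n * (1 - A)\<close>. For \<open>A = 1\<close> the second identity
  reads \<open>B x = x\<close>, which is the case \<open>t = 0\<close>.\<close>

lemma scaled_resolvent_inverse:
  fixes A :: "'a::{real_inner,banach} \<Rightarrow>\<^sub>L 'a" and n :: nat
  assumes A: "pos_contraction A"
  defines "B \<equiv> cfc A (scaled_resolvent_fun n)"
  shows "B y + real n *\<^sub>R (B y - A (B y)) = y" "B (x + real n *\<^sub>R (x - A x)) = x"
proof -
  note cont = scaled_resolvent_fun(1)[of n]
  have one: "cfc A (\<lambda>f. (1 + real n * (1 - f)) * scaled_resolvent_fun n f) = id_blinfun"
  proof -
    have "cfc A (\<lambda>f. (1 + real n * (1 - f)) * scaled_resolvent_fun n f) = cfc A (\<lambda>_. 1)"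
    proof (rule cfc_cong)
      fix f :: real assume "f \<in> {0..1}"
      then have "0 \<le> real n * (1 - f)" by simp
      then show "(1 + real n * (1 - f)) * scaled_resolvent_fun n f = 1"
        by (simp add: scaled_resolvent_fun_def)
    qed
    then show ?thesis by simp
  qed
  then have two: "cfc A (\<lambda>f. scaled_resolvent_fun n f * (1 + real n * (1 - f))) = id_blinfun"
    by (simp only: mult.commute)
  have "cfc A (\<lambda>f. real n * (1 - f)) = real n *\<^sub>R (id_blinfun - A)"
    by (subst cfc_scaleR) (simp_all add: cfc_diff cfc_id A continuous_intros)
  then have C: "cfc A (\<lambda>f. 1 + real n * (1 - f)) = id_blinfun + real n *\<^sub>R (id_blinfun - A)"
    by (simp add: cfc_add A continuous_intros)
  have "(id_blinfun + real n *\<^sub>R (id_blinfun - A)) o\<^sub>L B = id_blinfun"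
    unfolding B_def C[symmetric]
    by (subst cfc_mult[symmetric]) (auto intro!: A cont continuous_intros one)
  then have "((id_blinfun + real n *\<^sub>R (id_blinfun - A)) o\<^sub>L B) y = y" by simp
  then show "B y + real n *\<^sub>R (B y - A (B y)) = y"
    by (simp add: blinfun.bilinear_simps)
  have "B o\<^sub>L (id_blinfun + real n *\<^sub>R (id_blinfun - A)) = id_blinfun"
    unfolding B_def C[symmetric]
    by (subst cfc_mult[symmetric]) (auto intro!: A cont continuous_intros two)
  then have "(B o\<^sub>L (id_blinfun + real n *\<^sub>R (id_blinfun - A))) x = x" by simp
  then show "B (x + real n *\<^sub>R (x - A x)) = x"
    by (simp add: blinfun.bilinear_simps)
qed

lemma pos_contractionI:
  assumes "bounded_self_adjoint A" "bounded_nonneg A" "norm A \<le> 1"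
  shows "pos_contraction A"
  using assms
  by (auto simp: pos_contraction_def bounded_self_adjoint_def bounded_nonneg_def inner_eq_Re_cinner)

section \<open>Comparing the two modes of convergence\<close>

lemma exp_fun_eq_exp_of_resolvent:
  assumes "0 \<le> t" "r \<in> {0..1}"
  shows "exp_fun 1 (resolvent_fun t r) = exp_fun t r"
proof (cases "t = 0 \<or> r = 0")
  case False
  with assms have r: "0 < r" "0 < t" by auto
  have d: "0 < r + t * (1 - r)" using assms(2) r by (intro resolvent_denominator_pos) auto
  have "1 - 1 / (r / (r + t * (1 - r))) = t * (1 - 1 / r)"
    using r by (simp add: field_simps)
  then show ?thesis using r d by (simp add: exp_fun_def resolvent_fun_def)
qed (auto simp: exp_fun_def resolvent_fun_def)

lemma resolvent_fun_eq_resolvent_of_exp: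
  assumes "0 \<le> t" "r \<in> {0..1}"
  shows "resolvent_of_exp (exp_fun t r) = resolvent_fun t r"
proof (cases "t = 0 \<or> r = 0")
  case False
  with assms have r: "0 < r" "0 < t" by auto
  have d: "0 < r + t * (1 - r)" using assms(2) r by (intro resolvent_denominator_pos) auto
  have "1 - t * (1 - 1 / r) = (r + t * (1 - r)) / r"
    using r by (simp add: field_simps)
  then show ?thesis using r by (simp add: resolvent_of_exp_def exp_fun_def resolvent_fun_def)
qed (auto simp: resolvent_of_exp_def exp_fun_def resolvent_fun_def)

text \<open>This form serves both implications: \<open>Z\<close> is nearly \<open>g\<close> of \<open>X\<close>, with an error \<open>c n\<close> uniform in \<open>t\<close>, and the
  expected limit of \<open>Z\<close> is exactly \<open>g\<close> of the expected limit \<open>Y\<close> of \<open>X\<close>. The order of the quantifiers makes \<open>d\<close>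
  and \<open>N\<close> the same for all \<open>t\<close>.\<close>

lemma cfc_perturbation:
  fixes c :: "nat \<Rightarrow> real"
  assumes g: "continuous_on {0..1} g" and c: "c \<longlonglongrightarrow> 0" and e: "0 < e"
  shows "\<exists>d>0. \<exists>N. \<forall>n\<ge>N. \<forall>X Y Z :: 'a::{real_inner,banach} \<Rightarrow>\<^sub>L 'a. pos_contraction X \<longrightarrow> pos_contraction Y
    \<longrightarrow> norm (Z - cfc X g) \<le> c n \<longrightarrow> norm (X - Y) < d \<longrightarrow> norm (Z - cfc Y g) < e"
proof -
  obtain d where d: "0 < d" "\<And>X Y :: 'a \<Rightarrow>\<^sub>L 'a. pos_contraction X \<Longrightarrow> pos_contraction Y
    \<Longrightarrow> norm (X - Y) < d \<Longrightarrow> norm (cfc X g - cfc Y g) < e / 2"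
    using cfc_uniformly_continuous[OF g, of "e / 2"] e by (metis half_gt_zero)
  have "\<forall>\<^sub>F n in sequentially. c n < e / 2" using e by (intro order_tendstoD(2)[OF c]) simp
  then obtain N where N: "\<forall>n\<ge>N. c n < e / 2" by (auto simp: eventually_sequentially)
  show ?thesis
  proof (intro exI[of _ d] conjI d(1) exI[of _ N] allI impI)
    fix n and X Y Z :: "'a \<Rightarrow>\<^sub>L 'a"
    assume *: "N \<le> n" "pos_contraction X" "pos_contraction Y" "norm (Z - cfc X g) \<le> c n" "norm (X - Y) < d"
    have "norm (Z - cfc Y g) \<le> norm (Z - cfc X g) + norm (cfc X g - cfc Y g)"
      using norm_triangle_ineq[of "Z - cfc X g" "cfc X g - cfc Y g"] by simp
    also have "\<dots> < e / 2 + e / 2"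
      using d(2)[OF *(2,3,5)] *(4) N *(1) by (intro add_le_less_mono) force+
    finally show "norm (Z - cfc Y g) < e" by simp
  qed
qed

text \<open>The bound \<open>K\<close> ensures that the real supremum of \<open>a n\<close> is an upper bound of its values; for an unbounded
  family it would be an unspecified number.\<close>

lemma SUP_tendsto_0_transfer:
  fixes a b :: "nat \<Rightarrow> 't \<Rightarrow> real"
  assumes I: "I \<noteq> {}"
    and bound: "\<And>n t. t \<in> I \<Longrightarrow> 0 < n \<Longrightarrow> a n t \<le> K"
    and nonneg: "\<And>n t. 0 \<le> b n t"
    and transfer: "\<And>e. 0 < e \<Longrightarrow> \<exists>d>0. \<exists>N. \<forall>n\<ge>N. \<forall>t\<in>I. a n t < d \<longrightarrow> b n t < e"
    and lim: "(\<lambda>n. SUP t\<in>I. a n t) \<longlonglongrightarrow> 0"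
  shows "(\<lambda>n. SUP t\<in>I. b n t) \<longlonglongrightarrow> 0"
proof (rule tendstoI)
  fix e :: real assume e: "0 < e"
  obtain d N where d: "0 < d" and N: "\<And>n t. N \<le> n \<Longrightarrow> t \<in> I \<Longrightarrow> a n t < d \<Longrightarrow> b n t < e / 2"
    using transfer[of "e / 2"] e by (metis half_gt_zero)
  have "\<forall>\<^sub>F n in sequentially. (SUP t\<in>I. a n t) < d" by (rule order_tendstoD(2)[OF lim d])
  moreover have "\<forall>\<^sub>F n in sequentially. N \<le> n" by (rule eventually_ge_at_top)
  moreover have "\<forall>\<^sub>F n in sequentially. 0 < n" by (rule eventually_gt_at_top)
  ultimately show "\<forall>\<^sub>F n in sequentially. dist (SUP t\<in>I. b n t) 0 < e"
  proof eventually_elim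
    case (elim n)
    have b: "b n t \<le> e / 2" if t: "t \<in> I" for t
    proof -
      have "a n t \<le> (SUP t\<in>I. a n t)"
        using bound elim(3) by (intro cSUP_upper t bdd_aboveI2[of _ _ K]) auto
      then show ?thesis using N[OF elim(2) t] elim(1) by auto
    qed
    have le: "(SUP t\<in>I. b n t) \<le> e / 2" by (intro cSUP_least I b)
    obtain t where t: "t \<in> I" using I by blast
    have "b n t \<le> (SUP t\<in>I. b n t)" using b by (intro cSUP_upper t bdd_aboveI2[of _ _ "e / 2"])
    then have "0 \<le> (SUP t\<in>I. b n t)" using nonneg order_trans by blast
    then show ?case using le e by simp
  qed
qed

theorem theorem2p5:
  fixes F S :: "real \<Rightarrow> ('a::complex_hilbert \<Rightarrow>\<^sub>L 'a)"
    and H :: "'a operator"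
  assumes "measurable_family F"
    and "\<And>t. t \<ge> 0 \<Longrightarrow> bounded_self_adjoint (F t)"
    and "\<And>t. t \<ge> 0 \<Longrightarrow> bounded_nonneg (F t)"
    and "\<And>t. t \<ge> 0 \<Longrightarrow> norm (F t) \<le> 1"
    and "F 0 = id_blinfun"
    and "\<And>\<tau>. \<tau> > 0 \<Longrightarrow> S \<tau> = (1 / \<tau>) *\<^sub>R (id_blinfun - F \<tau>)"
    and "op_self_adjoint H"
    and "op_nonneg H"
    and "\<And>x. ((\<lambda>\<tau>. inv_one_plus 1 (of_bounded (S \<tau>)) x) \<longlongrightarrow> inv_one_plus 1 H x) (at_right 0)"
  shows "(\<forall>I. I \<subseteq> {0..} \<and> I \<noteq> {} \<and> is_interval I \<and> bounded I \<longrightarrow>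
            (\<lambda>n::nat. SUP t\<in>I. norm (bpower (F (t / real n)) n - exp_neg t H)) \<longlonglongrightarrow> 0)
     \<longleftrightarrow> (\<forall>I. I \<subseteq> {0..} \<and> I \<noteq> {} \<and> is_interval I \<and> bounded I \<longrightarrow>
            (\<lambda>n::nat. SUP t\<in>I. norm (inv_one_plus t (of_bounded (S (t / real n))) - inv_one_plus t H))
              \<longlonglongrightarrow> 0)"
proof -
  have lin: "op_linear H" using assms(7) by (simp add: op_self_adjoint_def)
  obtain R where R: "unit_resolvent H R" using ex_unit_resolvent[OF assms(7,8)] by blast
  then have posR: "pos_contraction R" by (simp add: unit_resolvent_def)
  have posF: "pos_contraction (F t)" if "0 \<le> t" for t
    using assms(2-4) that by (intro pos_contractionI)
  define P where "P n t = bpower (F (t / real n)) n" for n t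
  define E where "E t = exp_neg t H" for t
  define Q where "Q n t = inv_one_plus t (of_bounded (S (t / real n)))" for n t
  define J where "J t = inv_one_plus t H" for t
  have E: "E t = cfc R (exp_fun t)" and J: "J t = cfc R (resolvent_fun t)" if "0 \<le> t" for t
    unfolding E_def J_def
    using exp_neg_eq_cfc[OF assms(7,8) R that] inv_one_plus_eq_cfc[OF lin assms(8) R that] by auto
  have P: "P n t = cfc (F (t / real n)) (\<lambda>f. f ^ n)" if "0 \<le> t" for n t
    unfolding P_def using that by (intro bpower_eq_cfc posF) simp
  have Q: "Q n t = cfc (F (t / real n)) (scaled_resolvent_fun n)" if t: "0 \<le> t" and n: "0 < n" for n t
  proof -
    have "pos_contraction (F (t / real n))" using t by (intro posF) simp
    note inv = scaled_resolvent_inverse[OF this, of n]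
    show ?thesis
    proof (cases "t = 0")
      case True
      have "cfc (F (t / real n)) (scaled_resolvent_fun n) = id_blinfun"
        using inv(2) assms(5) True by (intro blinfun_eqI) simp
      then show ?thesis using True by (simp add: Q_def inv_one_plus_def)
    next
      case False
      then have "S (t / real n) = (real n / t) *\<^sub>R (id_blinfun - F (t / real n))"
        using assms(6)[of "t / real n"] t n by simp
      then have "one_plus t (of_bounded (S (t / real n)))
          = (\<lambda>x. Some (x + real n *\<^sub>R (x - F (t / real n) x)))"
        using False by (simp add: one_plus_def of_bounded_def fun_eq_iff blinfun.bilinear_simps)
      then have "bounded_inverse (one_plus t (of_bounded (S (t / real n))))
          = cfc (F (t / real n)) (scaled_resolvent_fun n)"
        using inv by (intro bounded_inverse_eqI) auto
      then show ?thesis using False by (simp add: Q_def inv_one_plus_def)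
    qed
  qed
  have posE: "pos_contraction (E t)" and posJ: "pos_contraction (J t)" if "0 \<le> t" for t
    unfolding E[OF that] J[OF that]
    by (intro pos_contraction_cfc posR continuous_on_exp_fun exp_fun_image continuous_on_resolvent_fun
        resolvent_fun_bounds that)+
  have posP: "pos_contraction (P n t)" if "0 \<le> t" for n t
    unfolding P[OF that] using that
    by (intro pos_contraction_cfc posF continuous_intros) (auto simp: power_le_one)
  have posQ: "pos_contraction (Q n t)" if "0 \<le> t" "0 < n" for n t
    unfolding Q[OF that] using that by (intro pos_contraction_cfc posF scaled_resolvent_fun) auto
  have bound: "norm (A - B) \<le> 2" if "pos_contraction A" "pos_contraction B" for A B :: "'a \<Rightarrow>\<^sub>L 'a"
    using that norm_triangle_ineq4[of A B] by (simp add: pos_contraction_def)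
  have E_of_J: "E t = cfc (J t) (exp_fun 1)" if "0 \<le> t" for t
    unfolding E[OF that] J[OF that]
    by (subst cfc_cfc[OF posR])
      (auto intro!: continuous_on_resolvent_fun continuous_on_exp_fun resolvent_fun_bounds that
        cfc_cong exp_fun_eq_exp_of_resolvent[symmetric])
  have J_of_E: "J t = cfc (E t) resolvent_of_exp" if "0 \<le> t" for t
    unfolding E[OF that] J[OF that]
    by (subst cfc_cfc[OF posR])
      (auto intro!: continuous_on_resolvent_of_exp continuous_on_exp_fun exp_fun_image that
        cfc_cong resolvent_fun_eq_resolvent_of_exp[symmetric])
  have P_near: "norm (P n t - cfc (Q n t) (exp_fun 1)) \<le> 4 / real (n - 1)" if t: "0 \<le> t" and n: "2 \<le> n" for n t
  proof -
    have A: "pos_contraction (F (t / real n))" using t by (intro posF) simp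
    have "cfc (Q n t) (exp_fun 1) = cfc (F (t / real n)) (\<lambda>f. exp_fun 1 (scaled_resolvent_fun n f))"
      using n unfolding Q[OF t]
      by (subst Q[OF t]) (auto intro!: cfc_cfc A scaled_resolvent_fun continuous_on_exp_fun)
    also have "\<dots> = cfc (F (t / real n)) (\<lambda>f. exp (- (real n * (1 - f))))"
    proof (rule cfc_cong)
      fix f :: real assume "f \<in> {0..1}"
      then have "0 \<le> real n * (1 - f)" by simp
      then show "exp_fun 1 (scaled_resolvent_fun n f) = exp (- (real n * (1 - f)))"
        by (simp add: exp_fun_def scaled_resolvent_fun_def)
    qed
    finally have eq: "cfc (Q n t) (exp_fun 1) = cfc (F (t / real n)) (\<lambda>f. exp (- (real n * (1 - f))))" .
    show ?thesis
      unfolding eq P[OF t]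
    proof (rule cfc_diff_norm_le[OF A])
      fix f :: real assume "f \<in> {0..1}"
      with power_near_exp[OF this, of "n - 1"] n
      show "\<bar>f ^ n - exp (- (real n * (1 - f)))\<bar> \<le> 4 / real (n - 1)" by simp
    qed (intro continuous_intros)+
  qed
  have Q_near: "norm (Q n t - cfc (P n t) resolvent_of_exp) \<le> 1 / real n" if t: "0 \<le> t" and n: "0 < n" for n t
  proof -
    have A: "pos_contraction (F (t / real n))" using t by (intro posF) simp
    have "continuous_on {0..1} (\<lambda>f::real. resolvent_of_exp (f ^ n))"
      by (intro continuous_on_compose2[OF continuous_on_resolvent_of_exp] continuous_intros)
        (auto simp: power_le_one)
    moreover have "cfc (P n t) resolvent_of_exp = cfc (F (t / real n)) (\<lambda>f. resolvent_of_exp (f ^ n))"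
      unfolding P[OF t] by (intro cfc_cfc A continuous_intros continuous_on_resolvent_of_exp)
        (auto simp: power_le_one)
    ultimately show ?thesis
      unfolding Q[OF t n]
      using resolvent_near_resolvent_of_power[OF _ n]
      by (auto intro!: cfc_diff_norm_le A scaled_resolvent_fun simp: scaled_resolvent_fun_def[of n])
  qed
  have "(\<lambda>n. SUP t\<in>I. norm (P n t - E t)) \<longlonglongrightarrow> 0 \<longleftrightarrow> (\<lambda>n. SUP t\<in>I. norm (Q n t - J t)) \<longlonglongrightarrow> 0"
    if I: "I \<subseteq> {0..}" "I \<noteq> {}" for I
  proof
    assume lim: "(\<lambda>n. SUP t\<in>I. norm (P n t - E t)) \<longlonglongrightarrow> 0"
    show "(\<lambda>n. SUP t\<in>I. norm (Q n t - J t)) \<longlonglongrightarrow> 0"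
    proof (rule SUP_tendsto_0_transfer[OF I(2) _ _ _ lim])
      show "norm (P n t - E t) \<le> 2" if "t \<in> I" "0 < n" for n t
        using that I by (intro bound posP posE) auto
      fix e :: real assume "0 < e"
      have "(\<lambda>n. 1 / real n) \<longlonglongrightarrow> 0" by (rule lim_1_over_n)
      from cfc_perturbation[OF continuous_on_resolvent_of_exp this \<open>0 < e\<close>, where 'a='a]
      obtain d N where d: "0 < d" "\<And>n X Y Z :: 'a \<Rightarrow>\<^sub>L 'a. N \<le> n \<Longrightarrow> pos_contraction X \<Longrightarrow> pos_contraction Y
        \<Longrightarrow> norm (Z - cfc X resolvent_of_exp) \<le> 1 / real n \<Longrightarrow> norm (X - Y) < d
        \<Longrightarrow> norm (Z - cfc Y resolvent_of_exp) < e"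
        by blast
      show "\<exists>d>0. \<exists>N. \<forall>n\<ge>N. \<forall>t\<in>I. norm (P n t - E t) < d \<longrightarrow> norm (Q n t - J t) < e"
      proof (intro exI[of _ d] conjI d(1) exI[of _ "max N 1"] allI impI ballI)
        fix n t assume n: "max N 1 \<le> n" and t: "t \<in> I" and close: "norm (P n t - E t) < d"
        have "0 \<le> t" using t I by auto
        then show "norm (Q n t - J t) < e"
          unfolding J_of_E[OF \<open>0 \<le> t\<close>]
          using n by (intro d(2)[OF _ posP posE Q_near close]) auto
      qed
    qed simp
  next
    assume lim: "(\<lambda>n. SUP t\<in>I. norm (Q n t - J t)) \<longlonglongrightarrow> 0"
    show "(\<lambda>n. SUP t\<in>I. norm (P n t - E t)) \<longlonglongrightarrow> 0"
    proof (rule SUP_tendsto_0_transfer[OF I(2) _ _ _ lim])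
      show "norm (Q n t - J t) \<le> 2" if "t \<in> I" "0 < n" for n t
        using that I by (intro bound posQ posJ) auto
      fix e :: real assume "0 < e"
      have "(\<lambda>n. 4 * (1 / real n)) \<longlonglongrightarrow> 4 * 0" by (intro tendsto_mult_left lim_1_over_n)
      then have "(\<lambda>n. 4 / real (Suc n - 1)) \<longlonglongrightarrow> 0" by simp
      then have "(\<lambda>n. 4 / real (n - 1)) \<longlonglongrightarrow> 0" by (rule LIMSEQ_imp_Suc)
      from cfc_perturbation[OF continuous_on_exp_fun[OF zero_le_one] this \<open>0 < e\<close>, where 'a='a]
      obtain d N where d: "0 < d" "\<And>n X Y Z :: 'a \<Rightarrow>\<^sub>L 'a. N \<le> n \<Longrightarrow> pos_contraction X \<Longrightarrow> pos_contraction Y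
        \<Longrightarrow> norm (Z - cfc X (exp_fun 1)) \<le> 4 / real (n - 1) \<Longrightarrow> norm (X - Y) < d
        \<Longrightarrow> norm (Z - cfc Y (exp_fun 1)) < e"
        by blast
      show "\<exists>d>0. \<exists>N. \<forall>n\<ge>N. \<forall>t\<in>I. norm (Q n t - J t) < d \<longrightarrow> norm (P n t - E t) < e"
      proof (intro exI[of _ d] conjI d(1) exI[of _ "max N 2"] allI impI ballI)
        fix n t assume n: "max N 2 \<le> n" and t: "t \<in> I" and close: "norm (Q n t - J t) < d"
        have "0 \<le> t" using t I by auto
        then show "norm (P n t - E t) < e"
          unfolding E_of_J[OF \<open>0 \<le> t\<close>]
          using n by (intro d(2)[OF _ posQ posJ P_near close]) auto
      qed
    qed simp
  qed
  then show ?thesis unfolding P_def E_def Q_def J_def by blast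
qed

end
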